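(* Let $T\ge 2$, let $0<\alpha\le 1$, and let the sequence $\{\boldsymbol{x}_{i,t}\}$ be generated by the algorithm DOFW-CO (described in the context) with step size $\alpha$ over $T$ rounds. Suppose: (1) (Network) (a) there is a scalar $\zeta>0$ such that, for $t\in\{1,\dots,T\}$, $[A_t]_{ij}>\zeta$ whenever $[A_t]_{ij}>0$; (b) $\sum_{j=1}^n[A_t]_{ij}=\sum_{i=1}^n[A_t]_{ij}=1$ for all $t\in\{1,\dots,T\}$ and all $i,j\in\mathcal V$; (c) for some positive integer $Q$, the union graph $\bigcup_{i=kQ+1}^{(k+1)Q}\mathcal G_i$ is strongly connected for every integer $k\ge 0$. (2) $\|\boldsymbol{x}_1-\boldsymbol{x}_2\|\le M$ for all $\boldsymbol{x}_1,\boldsymbol{x}_2\in\boldsymbol{X}$, where $M$ is finite. (3) Each $f_{i,t}$ is $L_X$-Lipschitz on $\boldsymbol{X}$: $|f_{i,t}(\boldsymbol{x}_1)-f_{i,t}(\boldsymbol{x}_2)|\le L_X\|\boldsymbol{x}_1-\boldsymbol{x}_2\|$ for all $\boldsymbol{x}_1,\boldsymbol{x}_2\in\boldsymbol{X}$, with $L_X>0$. (4) Each gradient $\nabla f_{i,t}$ is $G_X$-Lipschitz on $\boldsymbol{X}$: $\|\nabla f_{i,t}(\boldsymbol{x}_1)-\nabla f_{i,t}(\boldsymbol{x}_2)\|\le G_X\|\boldsymbol{x}_1-\boldsymbol{x}_2\|$ for all $\boldsymbol{x}_1,\boldsymbol{x}_2\in\boldsymbol{X}$. Then for every agent $j\in\mathcal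 V$, $$\mathbf{Regret}_d^j(T)\le C_1+C_2\,\alpha T+\frac{2n}{\alpha}H_T+\frac{C_3}{\alpha}+C_4 D_T,$$ where $$\sigma=\Big(1-\frac{\zeta}{4n^2}\Big)^{1/Q},\qquad \Gamma=\Big(1-\frac{\zeta}{4n^2}\Big)^{(1-2Q)/Q},$$ $$C_1=nL_X\sum_{i=1}^n\|\boldsymbol{x}_{i,1}-\boldsymbol{x}_{avg,1}\|+\frac{2Mn\Gamma}{1-\sigma}\sum_{i=1}^n\|\nabla f_{i,1}(\hat{\boldsymbol{x}}_{i,1})\|+\Big(nL_X+2MG_X+\frac{4Mn\Gamma G_X}{1-\sigma}\Big)\frac{n\Gamma}{1-\sigma}\sum_{i=1}^n\|\boldsymbol{x}_{i,1}\|,$$ $$C_2=2n^2L_XM+\Big(4MG_X+nL_X+\frac{4Mn\Gamma G_X}{1-\sigma}\Big)\frac{n^2M\Gamma}{1-\sigma}+\frac{nG_XM^2}{2},$$ $$C_3=nL_XM,\qquad C_4=\frac{2Mn^2\Gamma}{1-\sigma}+nM.$$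
   Context: Setting. $\mathcal V=\{1,\dots,n\}$ is a set of agents. $\boldsymbol{X}\subset\mathbb R^d$ is a nonempty convex compact set and $\|\cdot\|$ is the Euclidean norm. For each agent $i$ and time $t\ge1$, the real-valued loss function $f_{i,t}$ is convex on $\boldsymbol{X}$ and differentiable at the points of $\boldsymbol{X}$, with gradient $\nabla f_{i,t}$. Put $F_t(\boldsymbol{x})=\sum_{i=1}^n f_{i,t}(\boldsymbol{x})$ and let $\boldsymbol{x}_t^*\in\arg\min_{\boldsymbol{x}\in\boldsymbol{X}}F_t(\boldsymbol{x})$. Network. For each $t\ge 1$, $\mathcal G_t=\{\mathcal V,\mathcal E_t,A_t\}$ is a directed graph with edge set $\mathcal E_t\subseteq\mathcal V\times\mathcal V$ and weight matrix $A_t\in\mathbb R^{n\times n}$. Let $\mathcal N_i^{in}(t)=\{j:(j,i)\in\mathcal E_t\}\cup\{i\}$. Then $[A_t]_{ij}>0$ if $j\in\mathcal N_i^{in}(t)$ and $[A_t]_{ij}=0$ otherwise. A union of graphs has vertex set $\mathcal V$ and the union of the edge sets. Algorithm DOFW-CO with step size $\alpha\in(0,1]$ and arbitrary initial points $\boldsymbol{x}_{i,1}\in\boldsymbol{X}$. For $t=1,\dots,T$ and every $i\in\mathcal V$: $\hat{\boldsymbol{x}}_{i,t}=\sum_{j\in\mathcal N_i^{in}(t)}[A_t]_{ij}\boldsymbol{x}_{j,t}$; $\overline\nabla f_{i,1}=\nabla f_{i,1}(\hat{\boldsymbol{x}}_{i,1})$ if $t=1$, and $\overline\nabla f_{i,t}=\widehat\nabla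 f_{i,t-1}+\nabla f_{i,t}(\hat{\boldsymbol{x}}_{i,t})-\nabla f_{i,t-1}(\hat{\boldsymbol{x}}_{i,t-1})$ if $t\ge2$; $\widehat\nabla f_{i,t}=\sum_{j\in\mathcal N_i^{in}(t)}[A_t]_{ij}\overline\nabla f_{j,t}$; $\boldsymbol{v}_{i,t}\in\arg\min_{\boldsymbol{x}\in\boldsymbol{X}}\langle\boldsymbol{x},\widehat\nabla f_{i,t}\rangle$; $\boldsymbol{x}_{i,t+1}=\hat{\boldsymbol{x}}_{i,t}+\alpha(\boldsymbol{v}_{i,t}-\hat{\boldsymbol{x}}_{i,t})$. Notation. $\boldsymbol{x}_{avg,t}=\frac1n\sum_{i=1}^n\boldsymbol{x}_{i,t}$. The dynamic regret of agent $j$ is $\mathbf{Regret}_d^j(T)=\sum_{t=1}^TF_t(\boldsymbol{x}_{j,t})-\sum_{t=1}^TF_t(\boldsymbol{x}_t^* )$. The function variation is $H_T=\sum_{t=1}^T\max_{i\in\mathcal V}\max_{\boldsymbol{x}\in\boldsymbol{X}}|f_{i,t+1}(\boldsymbol{x})-f_{i,t}(\boldsymbol{x})|$ and the gradient variation is $D_T=\sum_{t=1}^T\max_{i\in\mathcal V}\max_{\boldsymbol{x}\in\boldsymbol{X}}\|\nabla f_{i,t+1}(\boldsymbol{x})-\nabla f_{i,t}(\boldsymbol{x})\|$. *)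

theory Defs
  imports "Graph_Theory.Digraph_Component" "HOL-Analysis.Analysis"
begin

text \<open>
  The agents are the elements of a finite type \<open>'v\<close>, with \<open>n = CARD('v)\<close>, and times are natural
  numbers starting from \<open>1\<close>. An edge set is a relation on \<open>'v\<close>; the pair \<open>(j, i)\<close> is an edge from
  \<open>j\<close> to \<open>i\<close>.
\<close>

definition in_neighbors :: "'v rel \<Rightarrow> 'v \<Rightarrow> 'v set" where
  "in_neighbors E i = {j. (j, i) \<in> E} \<union> {i}"

definition union_graph :: "(nat \<Rightarrow> 'v rel) \<Rightarrow> nat set \<Rightarrow> 'v pair_pre_digraph" where
  "union_graph E I = \<lparr>pverts = UNIV, parcs = (\<Union>t\<in>I. E t)\<rparr>"

text \<open>The entry \<open>A $ i $ j\<close> weighs what \<open>i\<close> receives from \<open>j\<close>.\<close>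

definition compatible_weights :: "'v::finite rel \<Rightarrow> real^'v^'v \<Rightarrow> bool" where
  "compatible_weights E A \<longleftrightarrow>
     (\<forall>i j. (j \<in> in_neighbors E i \<longrightarrow> A $ i $ j > 0) \<and> (j \<notin> in_neighbors E i \<longrightarrow> A $ i $ j = 0))"

definition agent_avg :: "('v::finite \<Rightarrow> 'a::real_vector) \<Rightarrow> 'a" where
  "agent_avg y = (1 / real CARD('v)) *\<^sub>R (\<Sum>i\<in>UNIV. y i)"

definition total_loss :: "('v::finite \<Rightarrow> nat \<Rightarrow> 'a \<Rightarrow> real) \<Rightarrow> nat \<Rightarrow> 'a \<Rightarrow> real" where
  "total_loss f t y = (\<Sum>i\<in>UNIV. f i t y)"

text \<open>
  Runs of the algorithm over \<open>T\<close> rounds. In the order of the arguments, \<open>x\<close>, \<open>xh\<close>, \<open>gb\<close>, \<open>gh\<close>, \<open>v\<close>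
  are the iterates, the mixed iterates, the gradient trackers before and after mixing, and the
  minimisers of the linearised problem. It is a relation because the minimisers \<open>v i t\<close> need not
  be unique.
\<close>

definition dofw_co ::
  "'a::euclidean_space set \<Rightarrow> ('v::finite \<Rightarrow> nat \<Rightarrow> 'a \<Rightarrow> 'a) \<Rightarrow> (nat \<Rightarrow> 'v rel) \<Rightarrow>
   (nat \<Rightarrow> real^'v^'v) \<Rightarrow> real \<Rightarrow> nat \<Rightarrow>
   ('v \<Rightarrow> nat \<Rightarrow> 'a) \<Rightarrow> ('v \<Rightarrow> nat \<Rightarrow> 'a) \<Rightarrow> ('v \<Rightarrow> nat \<Rightarrow> 'a) \<Rightarrow> ('v \<Rightarrow> nat \<Rightarrow> 'a) \<Rightarrow>
   ('v \<Rightarrow> nat \<Rightarrow> 'a) \<Rightarrow> bool" where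
  "dofw_co X grad E A \<alpha> T x xh gb gh v \<longleftrightarrow>
     (\<forall>i. x i 1 \<in> X) \<and>
     (\<forall>t\<in>{1..T}. \<forall>i.
        xh i t = (\<Sum>j\<in>in_neighbors (E t) i. A t $ i $ j *\<^sub>R x j t) \<and>
        gb i t = (if t = 1 then grad i 1 (xh i 1)
                  else gh i (t - 1) + grad i t (xh i t) - grad i (t - 1) (xh i (t - 1))) \<and>
        gh i t = (\<Sum>j\<in>in_neighbors (E t) i. A t $ i $ j *\<^sub>R gb j t) \<and>
        is_arg_min (\<lambda>y. y \<bullet> gh i t) (\<lambda>y. y \<in> X) (v i t) \<and>
        x i (t + 1) = xh i t + \<alpha> *\<^sub>R (v i t - xh i t))"

definition dynamic_regret ::
  "('v::finite \<Rightarrow> nat \<Rightarrow> 'a \<Rightarrow> real) \<Rightarrow> ('v \<Rightarrow> nat \<Rightarrow> 'a) \<Rightarrow> (nat \<Rightarrow> 'a) \<Rightarrow> 'v \<Rightarrow> nat \<Rightarrow> real" where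
  "dynamic_regret f x xstar j T =
     (\<Sum>t=1..T. total_loss f t (x j t)) - (\<Sum>t=1..T. total_loss f t (xstar t))"

text \<open>
  In the next two definitions the suprema over \<open>X\<close> are maxima when \<open>X\<close> is nonempty and compact and
  the losses and their gradients are Lipschitz on \<open>X\<close>.
\<close>

definition function_variation ::
  "'a set \<Rightarrow> ('v::finite \<Rightarrow> nat \<Rightarrow> 'a \<Rightarrow> real) \<Rightarrow> nat \<Rightarrow> real" where
  "function_variation X f T =
     (\<Sum>t=1..T. MAX i. (SUP y\<in>X. \<bar>f i (t + 1) y - f i t y\<bar>))"

definition gradient_variation ::
  "'a::euclidean_space set \<Rightarrow> ('v::finite \<Rightarrow> nat \<Rightarrow> 'a \<Rightarrow> 'a) \<Rightarrow> nat \<Rightarrow> real" where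
  "gradient_variation X grad T =
     (\<Sum>t=1..T. MAX i. (SUP y\<in>X. norm (grad i (t + 1) y - grad i t y)))"

end

theory Submission
  imports Defs
begin

text \<open>
  The regret of agent \<open>j\<close> splits into the loss caused by the distance of \<open>x j t\<close> from the average iterate
  \<open>x_avg t\<close> and the optimality gap of that average.
  
  Both parts rest on one consensus estimate. Averaging with a doubly stochastic matrix never increases
  the sum of squared deviations from the mean. Over a block of \<open>Q\<close> rounds whose union graph is strongly
  connected it shrinks this sum by the factor \<open>1 - \<zeta> / (2 n\<^sup>2)\<close>. To see this, sort the values at the
  beginning of the block: each gap between consecutive values is a cut of the agents, some round of the block is the first
  to send weight across this cut, and in that round the square of the gap is lost with weight at least
  \<open>\<zeta> / 2\<close> (\<open>spread_mixes_block_real\<close>). Hence a disturbance injected into the averaging process decays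
  like \<open>\<Gamma> \<sigma>\<^sup>l\<close>, and in a process that is disturbed in every round the deviations from the mean sum up to at most
  \<open>\<Gamma> / (1 - \<sigma>)\<close> times the total size of the disturbances (\<open>driven_mixing_deviation_sum\<close>).
  
  The estimate is applied twice. For the mixed iterates the disturbances are the steps \<open>\<alpha> (v - xh)\<close>, of
  size at most \<open>\<alpha> M\<close>. For the gradient trackers they are the increments of the local gradients; these
  come from the variation of the losses in time, which gives \<open>D\<^sub>T\<close>, and from the movement of the mixed
  iterates, which the first application controls. Since mixing preserves averages, the average
  tracker is the average of the local gradients, so every tracker approximates the gradient of the
  average loss at \<open>x_avg t\<close>.
  
  The average performs Frank-Wolfe steps with these approximate gradients. Convexity turns each step
  into a decrease by \<open>\<alpha>\<close> times the optimality gap, up to the tracking error and the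
  curvature term \<open>n G (\<alpha> M)\<^sup>2 / 2\<close> (\<open>frank_wolfe_averaged_step\<close>). Summing these inequalities telescopes
  except that the losses change from round to round, and this costs \<open>2 n H\<^sub>T\<close>
  (\<open>telescoping_varying_function\<close>). Dividing by \<open>\<alpha>\<close> gives the regret bound
  \<open>dynamic_regret_le\<close>, which is at most the claimed one.
\<close>

section \<open>Mixing with doubly stochastic matrices\<close>

definition mix :: "real^'v^'v \<Rightarrow> ('v::finite \<Rightarrow> 'a::real_vector) \<Rightarrow> 'v \<Rightarrow> 'a" where
  "mix A y i = (\<Sum>k\<in>UNIV. A $ i $ k *\<^sub>R y k)"

primrec mixes :: "(nat \<Rightarrow> real^'v^'v) \<Rightarrow> nat \<Rightarrow> nat \<Rightarrow> ('v::finite \<Rightarrow> 'a::real_vector) \<Rightarrow> 'v \<Rightarrow> 'a" where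
  "mixes A s 0 y = y"
| "mixes A s (Suc k) y = mix (A (s + k)) (mixes A s k y)"

definition doubly_stochastic :: "real^'v^'v::finite \<Rightarrow> bool" where
  "doubly_stochastic A \<longleftrightarrow> (\<forall>i k. 0 \<le> A $ i $ k) \<and> (\<forall>i. (\<Sum>k\<in>UNIV. A $ i $ k) = 1)
     \<and> (\<forall>k. (\<Sum>i\<in>UNIV. A $ i $ k) = 1)"

text \<open>
  Weight may cross the cut in either direction: for \<open>crossing_weight\<close> it matters only that some agent averages values from both sides.
\<close>

definition crosses :: "real^'v^'v \<Rightarrow> 'v::finite set \<Rightarrow> bool" where
  "crosses A S \<longleftrightarrow> (\<exists>i k. A $ i $ k > 0 \<and> (i \<in> S) \<noteq> (k \<in> S))"

text \<open>
  The positive diagonal says that every agent keeps a share of its own value. Without it an agent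
  could merely swap values with others, and disagreement would not decrease.
\<close>

definition positive_above :: "real \<Rightarrow> real^'v^'v::finite \<Rightarrow> bool" where
  "positive_above \<zeta> A \<longleftrightarrow> (\<forall>i k. A $ i $ k > 0 \<longrightarrow> \<zeta> \<le> A $ i $ k) \<and> (\<forall>i. A $ i $ i > 0)"

definition spread :: "('v::finite \<Rightarrow> 'a::real_normed_vector) \<Rightarrow> real" where
  "spread y = (\<Sum>i\<in>UNIV. (norm (y i - agent_avg y))\<^sup>2)"

lemma agent_avg_mix:
  assumes "doubly_stochastic A"
  shows "agent_avg (mix A y) = agent_avg y"
proof -
  have "(\<Sum>i\<in>UNIV. mix A y i) = (\<Sum>k\<in>UNIV. (\<Sum>i\<in>UNIV. A $ i $ k) *\<^sub>R y k)"
    unfolding mix_def scaleR_left.sum by (rule sum.swap)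
  then show ?thesis
    using assms by (simp add: agent_avg_def doubly_stochastic_def)
qed

lemma sum_agent_avg: "(\<Sum>i\<in>(UNIV::'v::finite set). y i) = real CARD('v) *\<^sub>R agent_avg y"
  by (simp add: agent_avg_def)

text \<open>
  The parallel axis identity: the mixed terms vanish because the deviations from the mean sum to zero.
\<close>

lemma sum_sq_deviation:
  fixes y :: "'v::finite \<Rightarrow> 'a::real_inner"
  shows "(\<Sum>i\<in>UNIV. (norm (y i - c))\<^sup>2) = spread y + real CARD('v) * (norm (agent_avg y - c))\<^sup>2"
proof -
  let ?m = "agent_avg y"
  have "(norm (y i - c))\<^sup>2 = (norm (y i - ?m))\<^sup>2 + 2 * ((y i - ?m) \<bullet> (?m - c)) + (norm (?m - c))\<^sup>2" for i
    by (simp add: power2_norm_eq_inner algebra_simps inner_commute)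
  moreover have "(\<Sum>i\<in>UNIV. (y i - ?m) \<bullet> (?m - c)) = 0"
    by (simp add: inner_sum_left[symmetric] sum_subtractf sum_agent_avg sum_constant_scaleR)
  ultimately show ?thesis
    by (simp add: sum.distrib spread_def sum_distrib_left[symmetric])
qed

text \<open>
  This dissipation identity makes the loss of spread visible pair by pair. Row \<open>k\<close> contributes the
  variance of \<open>y\<close> under the probability weights \<open>A $ k\<close>; unit column sums turn the sum of the second
  moments back into that of \<open>y\<close>, and the mean is preserved.
\<close>

lemma spread_mix:
  fixes y :: "'v::finite \<Rightarrow> real"
  assumes A: "doubly_stochastic A"
  shows "spread y - spread (mix A y)
    = (\<Sum>k\<in>UNIV. \<Sum>i\<in>UNIV. \<Sum>j\<in>UNIV. A $ k $ i * A $ k $ j * (y i - y j)\<^sup>2) / 2"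
proof -
  have row: "(\<Sum>i\<in>UNIV. \<Sum>j\<in>UNIV. A $ k $ i * A $ k $ j * (y i - y j)\<^sup>2)
      = 2 * (\<Sum>i\<in>UNIV. A $ k $ i * (y i)\<^sup>2) - 2 * (mix A y k)\<^sup>2" for k
  proof -
    have r: "(\<Sum>i\<in>UNIV. A $ k $ i) = 1" using A by (simp add: doubly_stochastic_def)
    have "(\<Sum>i\<in>UNIV. \<Sum>j\<in>UNIV. A $ k $ i * A $ k $ j * (y i - y j)\<^sup>2)
      = (\<Sum>i\<in>UNIV. \<Sum>j\<in>UNIV. (A $ k $ i * (y i)\<^sup>2) * A $ k $ j)
      + (\<Sum>i\<in>UNIV. \<Sum>j\<in>UNIV. A $ k $ i * (A $ k $ j * (y j)\<^sup>2))
      - 2 * (\<Sum>i\<in>UNIV. \<Sum>j\<in>UNIV. (A $ k $ i * y i) * (A $ k $ j * y j))"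
      by (simp add: sum.distrib[symmetric] sum_subtractf[symmetric] sum_distrib_left power2_eq_square algebra_simps)
    also have "\<dots> = 2 * (\<Sum>i\<in>UNIV. A $ k $ i * (y i)\<^sup>2) - 2 * (mix A y k)\<^sup>2"
      by (simp add: sum_product[symmetric] r mix_def power2_eq_square)
    finally show ?thesis .
  qed
  have "(\<Sum>k\<in>UNIV. \<Sum>i\<in>UNIV. A $ k $ i * (y i)\<^sup>2) = (\<Sum>i\<in>UNIV. (\<Sum>k\<in>UNIV. A $ k $ i) * (y i)\<^sup>2)"
    unfolding sum_distrib_right by (rule sum.swap)
  also have "\<dots> = (\<Sum>i\<in>UNIV. (y i)\<^sup>2)" using A by (simp add: doubly_stochastic_def)
  finally have col: "(\<Sum>k\<in>UNIV. \<Sum>i\<in>UNIV. A $ k $ i * (y i)\<^sup>2) = (\<Sum>i\<in>UNIV. (y i)\<^sup>2)" .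
  show ?thesis
    using sum_sq_deviation[of y 0] sum_sq_deviation[of "mix A y" 0]
    by (simp add: row sum_subtractf sum_distrib_left[symmetric] col agent_avg_mix[OF A])
qed

text \<open>
  Pairs on different sides of the cut carry enough weight: if the agent \<open>k\<close> has an edge across the
  cut, it puts weights \<open>p\<close> and \<open>q\<close> with \<open>p + q = 1\<close> on the two sides. Both are at least \<open>\<zeta>\<close>, one
  because of the edge and the other because of the self-loop, and one of them is at least \<open>1 / 2\<close>. So
  \<open>2 p q\<close>, the weight of the separated pairs, is at least \<open>\<zeta>\<close>.
\<close>

section \<open>Contraction over a connected block of rounds\<close>

lemma crossing_weight:
  assumes A: "doubly_stochastic A" "positive_above \<zeta> A" and S: "crosses A S"
  shows "\<zeta> \<le> (\<Sum>k\<in>UNIV. \<Sum>i\<in>UNIV. \<Sum>j\<in>UNIV. if (i \<in> S) \<noteq> (j \<in> S) then A $ k $ i * A $ k $ j else 0)"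
    (is "_ \<le> (\<Sum>k\<in>UNIV. ?w k)")
proof -
  have nn: "0 \<le> A $ i $ k" for i k using A by (simp add: doubly_stochastic_def)
  obtain k l where kl: "A $ k $ l > 0" "(k \<in> S) \<noteq> (l \<in> S)" using S by (auto simp: crosses_def)
  have z: "\<zeta> \<le> A $ k $ l" "\<zeta> \<le> A $ k $ k"
    using A(2) kl by (auto simp: positive_above_def)
  let ?p = "\<Sum>i\<in>S. A $ k $ i" and ?q = "\<Sum>i\<in>-S. A $ k $ i"
  have ge: "\<zeta> \<le> (\<Sum>i\<in>B. A $ k $ i)" if "k \<in> B \<or> l \<in> B" for B
    using that z member_le_sum[of k B "\<lambda>i. A $ k $ i"] member_le_sum[of l B "\<lambda>i. A $ k $ i"] nn
    by (auto intro: order_trans)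
  have pq: "\<zeta> \<le> ?p" "\<zeta> \<le> ?q" using ge[of S] ge[of "-S"] kl(2) by auto
  have one: "?p + ?q = 1"
    using A(1) sum.union_disjoint[of S "-S" "\<lambda>i. A $ k $ i"] by (simp add: doubly_stochastic_def)
  have split: "(\<Sum>i\<in>UNIV. h i) = (\<Sum>i\<in>S. h i) + (\<Sum>i\<in>-S. h i)" for h :: "_ \<Rightarrow> real"
    using sum.union_disjoint[of S "-S" h] by simp
  have a: "(\<Sum>j\<in>UNIV. if (i \<in> S) \<noteq> (j \<in> S) then A $ k $ i * A $ k $ j else 0)
    = A $ k $ i * (if i \<in> S then ?q else ?p)" for i
    by (subst split) (simp add: sum_distrib_left)
  have "?w k = 2 * (?p * ?q)"
    unfolding a by (subst split) (simp add: sum_distrib_right[symmetric])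
  moreover have "\<zeta> \<le> 2 * (?p * ?q)"
  proof (cases "?p \<le> 1/2")
    case True
    have p0: "0 \<le> ?p" by (simp add: nn sum_nonneg)
    have "?p * (1/2) \<le> ?p * ?q" by (rule mult_left_mono) (use True one p0 in auto)
    then show ?thesis using pq(1) by linarith
  next
    case False
    have q0: "0 \<le> ?q" by (simp add: nn sum_nonneg)
    have "(1/2) * ?q \<le> ?p * ?q" by (rule mult_right_mono) (use False q0 in auto)
    then show ?thesis using pq(2) by linarith
  qed
  moreover have "?w k \<le> (\<Sum>k\<in>UNIV. ?w k)"
    by (rule member_le_sum) (auto intro!: sum_nonneg simp: nn)
  ultimately show ?thesis by linarith
qed

text \<open>
  The gaps occupy disjoint parts of \<open>[a, b]\<close>, so their sum is at most \<open>b - a\<close>, and the sum of the squares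
  of nonnegative numbers is at most the square of their sum.
\<close>

lemma sum_sq_gaps_le:
  fixes z :: "nat \<Rightarrow> real"
  assumes z: "mono z" and D: "finite D" and ab: "a \<le> b"
    and in_ab: "\<And>d. d \<in> D \<Longrightarrow> a \<le> z d \<and> z (Suc d) \<le> b"
  shows "(\<Sum>d\<in>D. (z (Suc d) - z d)\<^sup>2) \<le> (b - a)\<^sup>2"
proof (cases "D = {}")
  case False
  have g: "0 \<le> z (Suc d) - z d" for d using z by (simp add: monoD)
  have sub: "D \<subseteq> {Min D..<Suc (Max D)}" using D by (auto simp: less_Suc_eq_le)
  have "(\<Sum>d\<in>D. z (Suc d) - z d) \<le> (\<Sum>d\<in>{Min D..<Suc (Max D)}. z (Suc d) - z d)"
    by (rule sum_mono2[OF _ sub]) (use g in auto)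
  also have "\<dots> = z (Suc (Max D)) - z (Min D)"
    by (rule sum_Suc_diff') (meson D False Max_in Min_le le_SucI)
  also have "\<dots> \<le> b - a"
    using in_ab[of "Max D"] in_ab[of "Min D"] D False by auto
  finally have s: "(\<Sum>d\<in>D. z (Suc d) - z d) \<le> b - a" .
  have s0: "0 \<le> (\<Sum>d\<in>D. z (Suc d) - z d)" using g by (rule sum_nonneg)
  have "(\<Sum>d\<in>D. (z (Suc d) - z d)\<^sup>2) \<le> (\<Sum>d\<in>D. (z (Suc d) - z d) * (\<Sum>d\<in>D. z (Suc d) - z d))"
    unfolding power2_eq_square
    by (intro sum_mono mult_left_mono member_le_sum D g)
  also have "\<dots> = (\<Sum>d\<in>D. z (Suc d) - z d)\<^sup>2"
    by (simp add: sum_distrib_right power2_eq_square)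
  also have "\<dots> \<le> (b - a)\<^sup>2" using s s0 by (rule power_mono)
  finally show ?thesis .
qed simp

text \<open>
  The loss in one round. The cuts \<open>S d\<close> with \<open>d \<in> D\<close> are still clean: the values on their two sides are separated by the
  interval \<open>[z d, z (Suc d)]\<close>. A pair of agents therefore differs at least by the total length of
  the gaps of the cuts that separate it, and by \<open>sum_sq_gaps_le\<close> its squared difference pays for
  all these cuts at once. Each crossed cut then collects weight at least \<open>\<zeta>\<close> by \<open>crossing_weight\<close>.
\<close>

lemma spread_mix_crossed_cuts:
  fixes y :: "'v::finite \<Rightarrow> real"
  assumes A: "doubly_stochastic A" "positive_above \<zeta> A" and z: "mono z" and D: "finite D"
    and cr: "\<And>d. d \<in> D \<Longrightarrow> crosses A (S d)"
    and hi: "\<And>d i. d \<in> D \<Longrightarrow> i \<in> S d \<Longrightarrow> z (Suc d) \<le> y i"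
    and lo: "\<And>d i. d \<in> D \<Longrightarrow> i \<notin> S d \<Longrightarrow> y i \<le> z d"
  shows "\<zeta> / 2 * (\<Sum>d\<in>D. (z (Suc d) - z d)\<^sup>2) \<le> spread y - spread (mix A y)"
proof -
  have nn: "0 \<le> A $ i $ k" for i k using A by (simp add: doubly_stochastic_def)
  let ?g = "\<lambda>d. (z (Suc d) - z d)\<^sup>2"
  let ?sep = "\<lambda>d i j. (i \<in> S d) \<noteq> (j \<in> S d)"
  \<comment> \<open>Two cuts may separate \<open>i\<close> and \<open>j\<close> in opposite directions, but then
     \<open>y i = y j\<close> and both gaps vanish.\<close>
  have pair: "(\<Sum>d\<in>D. if ?sep d i j then ?g d else 0) \<le> (y i - y j)\<^sup>2" for i j
  proof -
    have "(\<Sum>d\<in>{d\<in>D. ?sep d i j}. ?g d) \<le> (max (y i) (y j) - min (y i) (y j))\<^sup>2"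
    proof (rule sum_sq_gaps_le[OF z])
      fix d assume d: "d \<in> {d\<in>D. ?sep d i j}"
      then show "min (y i) (y j) \<le> z d \<and> z (Suc d) \<le> max (y i) (y j)"
        using hi[of d i] hi[of d j] lo[of d i] lo[of d j] by (auto simp: min_le_iff_disj le_max_iff_disj)
    qed (use D in auto)
    also have "\<dots> = (y i - y j)\<^sup>2" by (auto simp: max_def min_def power2_commute)
    finally show ?thesis using D by (simp add: sum.inter_filter)
  qed
  have "\<zeta> * (\<Sum>d\<in>D. ?g d) \<le> (\<Sum>d\<in>D. ?g d *
      (\<Sum>k\<in>UNIV. \<Sum>i\<in>UNIV. \<Sum>j\<in>UNIV. if ?sep d i j then A $ k $ i * A $ k $ j else 0))"
    unfolding sum_distrib_left
  proof (rule sum_mono)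
    fix d assume "d \<in> D"
    from mult_left_mono[OF crossing_weight[OF A cr[OF this]], of "?g d"]
    show "\<zeta> * ?g d \<le> (\<Sum>k\<in>UNIV. \<Sum>i\<in>UNIV. \<Sum>j\<in>UNIV. ?g d * (if ?sep d i j then A $ k $ i * A $ k $ j else 0))"
      by (simp add: mult.commute sum_distrib_left)
  qed
  also have "\<dots> = (\<Sum>k\<in>UNIV. \<Sum>i\<in>UNIV. \<Sum>j\<in>UNIV. A $ k $ i * A $ k $ j * (\<Sum>d\<in>D. if ?sep d i j then ?g d else 0))"
    unfolding sum_distrib_left
    \<comment> \<open>The sum over the cuts is moved inside the sums over agents one by one.\<close>
    apply (subst sum.swap, rule sum.cong[OF refl])
    apply (subst sum.swap, rule sum.cong[OF refl])
    apply (subst sum.swap, rule sum.cong[OF refl])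
    by (rule sum.cong) auto
  also have "\<dots> \<le> (\<Sum>k\<in>UNIV. \<Sum>i\<in>UNIV. \<Sum>j\<in>UNIV. A $ k $ i * A $ k $ j * (y i - y j)\<^sup>2)"
    by (intro sum_mono mult_left_mono pair) (simp add: nn)
  also have "\<dots> = 2 * (spread y - spread (mix A y))" by (simp add: spread_mix[OF A(1)])
  finally show ?thesis by simp
qed

text \<open>
  An agent of \<open>S\<close> averages only values of agents of \<open>S\<close>, so bounds that hold throughout \<open>S\<close> persist.
\<close>

lemma mix_uncrossed:
  fixes y :: "'v::finite \<Rightarrow> real"
  assumes A: "doubly_stochastic A" and S: "\<not> crosses A S" and i: "i \<in> S"
  shows "(\<And>k. k \<in> S \<Longrightarrow> b \<le> y k) \<Longrightarrow> b \<le> mix A y i"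
    and "(\<And>k. k \<in> S \<Longrightarrow> y k \<le> b) \<Longrightarrow> mix A y i \<le> b"
proof -
  have nn: "0 \<le> A $ i $ k" for k using A by (simp add: doubly_stochastic_def)
  have r: "b = (\<Sum>k\<in>UNIV. A $ i $ k * b)"
    using A by (simp add: doubly_stochastic_def sum_distrib_right[symmetric])
  have 0: "A $ i $ k = 0" if "k \<notin> S" for k
    using S i that nn[of k] unfolding crosses_def by (metis order_le_less)
  show "b \<le> mix A y i" if "\<And>k. k \<in> S \<Longrightarrow> b \<le> y k"
    unfolding mix_def by (subst r, rule sum_mono) (metis 0 mult_left_mono nn real_scaleR_def that mult_zero_left order_refl)
  show "mix A y i \<le> b" if "\<And>k. k \<in> S \<Longrightarrow> y k \<le> b"
    unfolding mix_def by (subst r, rule sum_mono) (metis 0 mult_left_mono nn real_scaleR_def that mult_zero_left order_refl)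
qed

lemma crosses_Compl [simp]: "crosses A (- S) = crosses A S"
  by (auto simp: crosses_def)

text \<open>
  The values in increasing order with multiplicity, and the upper sets of agents that they
  cut off. Equal values are ordered arbitrarily; the corresponding gaps are zero, so that no case
  distinction is needed. The sequence is continued constantly in order to be monotone on all of \<open>nat\<close>.
\<close>

lemma sorted_cuts:
  fixes y :: "'v::finite \<Rightarrow> real"
  obtains z :: "nat \<Rightarrow> real" and S :: "nat \<Rightarrow> 'v set"
  where "mono z" "\<And>i. z 0 \<le> y i" "\<And>i. y i \<le> z (CARD('v) - 1)"
    "\<And>d. d < CARD('v) - 1 \<Longrightarrow> S d \<noteq> {}" "\<And>d. d < CARD('v) - 1 \<Longrightarrow> S d \<noteq> UNIV"
    "\<And>d i. d < CARD('v) - 1 \<Longrightarrow> i \<in> S d \<Longrightarrow> z (Suc d) \<le> y i"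
    "\<And>d i. d < CARD('v) - 1 \<Longrightarrow> i \<notin> S d \<Longrightarrow> y i \<le> z d"
proof -
  obtain xs0 where xs0: "set xs0 = (UNIV::'v set)" "distinct xs0"
    using finite_distinct_list[of "UNIV::'v set"] by auto
  define xs where "xs = sort_key y xs0"
  have xs: "set xs = UNIV" "distinct xs" "sorted (map y xs)" using xs0 by (auto simp: xs_def)
  have len: "length xs = CARD('v)" using distinct_card[OF xs(2)] xs(1) by simp
  have pos: "0 < CARD('v)" by simp
  define z where "z d = y (xs ! min d (CARD('v) - 1))" for d
  have le: "y (xs ! a) \<le> y (xs ! b)" if "a \<le> b" "b < CARD('v)" for a b
    using sorted_nth_mono[OF xs(3), of a b] that len by simp
  have idx: "\<exists>a<CARD('v). xs ! a = i" for i using xs(1) len by (metis UNIV_I in_set_conv_nth)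
  define S where "S d = {xs ! a | a. d < a \<and> a < CARD('v)}" for d
  show ?thesis
  proof (rule that[of z S])
    show "mono z" unfolding z_def by (intro monoI le) (use pos in \<open>simp_all add: min_def, linarith\<close>)
    show "z 0 \<le> y i" for i using idx[of i] le[of 0] by (auto simp: z_def)
    show "y i \<le> z (CARD('v) - 1)" for i
      using idx[of i] le[of _ "CARD('v) - 1"] pos by (auto simp: z_def)
    fix d assume d: "d < CARD('v) - 1"
    then show "S d \<noteq> {}" by (auto simp: S_def intro!: exI[of _ "Suc d"])
    have "xs ! 0 \<notin> S d" using nth_eq_iff_index_eq[OF xs(2)] len by (auto simp: S_def)
    then show "S d \<noteq> UNIV" by auto
    show "z (Suc d) \<le> y i" if "i \<in> S d" for i
      using that d le[of "Suc d"] by (auto simp: S_def z_def min_def)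
    show "y i \<le> z d" if "i \<notin> S d" for i
      using that d idx[of i] le[of _ d] by (auto simp: S_def z_def min_def not_less)
  qed
qed

text \<open>
  The mean minimises the sum of squared deviations, so the spread is at most \<open>n\<close> times the square of
  \<open>z (n - 1) - z 0\<close>. This length is the sum of the \<open>n - 1\<close> gaps, and the inequality of Cauchy and Schwarz costs
  another factor \<open>n - 1\<close>.
\<close>

lemma spread_le_gaps:
  fixes y :: "'v::finite \<Rightarrow> real"
  assumes lo: "\<And>i. z 0 \<le> y i" and hi: "\<And>i. y i \<le> z (CARD('v) - 1)"
  shows "spread y \<le> (real CARD('v))\<^sup>2 * (\<Sum>d<CARD('v) - 1. (z (Suc d) - z d)\<^sup>2)"
proof -
  let ?n = "CARD('v)"
  have "spread y \<le> (\<Sum>i\<in>UNIV. (norm (y i - z 0))\<^sup>2)"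
    by (subst sum_sq_deviation) simp
  also have "\<dots> \<le> (\<Sum>i\<in>(UNIV::'v set). (z (?n - 1) - z 0)\<^sup>2)"
    using lo hi by (intro sum_mono power_mono) (simp_all only: real_norm_def abs_of_nonneg diff_ge_0_iff_ge diff_right_mono)
  also have "\<dots> = real ?n * (\<Sum>d<?n - 1. z (Suc d) - z d)\<^sup>2"
    by (simp add: sum_lessThan_telescope)
  also have "(\<Sum>d<?n - 1. z (Suc d) - z d)\<^sup>2 \<le> real (?n - 1) * (\<Sum>d<?n - 1. (z (Suc d) - z d)\<^sup>2)"
    using Cauchy_Schwarz_ineq_sum[of "\<lambda>_. 1" "\<lambda>d. z (Suc d) - z d" "{..<?n - 1}"] by simp
  also have "\<dots> \<le> real ?n * (\<Sum>d<?n - 1. (z (Suc d) - z d)\<^sup>2)"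
    by (intro mult_right_mono sum_nonneg) auto
  finally show ?thesis by (simp add: power2_eq_square mult.assoc)
qed

text \<open>
  Each cut of the initial values is charged to the first round that crosses it. Until that round
  \<open>mix_uncrossed\<close> keeps the cut clean, so \<open>spread_mix_crossed_cuts\<close> accounts for the square of its gap in full. As all cuts
  are crossed within the block, the total loss is at least \<open>\<zeta> / 2\<close> times the sum of the squared gaps,
  which \<open>spread_le_gaps\<close> compares with the spread.
\<close>

lemma spread_mixes_block_real:
  fixes y :: "'v::finite \<Rightarrow> real"
  assumes A: "\<And>k. k < Q \<Longrightarrow> doubly_stochastic (A (s + k))" "\<And>k. k < Q \<Longrightarrow> positive_above \<zeta> (A (s + k))"
    and \<zeta>: "0 \<le> \<zeta>"
    and conn: "\<And>S. S \<noteq> {} \<Longrightarrow> S \<noteq> UNIV \<Longrightarrow> \<exists>k<Q. crosses (A (s + k)) S"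
  shows "spread (mixes A s Q y) \<le> (1 - \<zeta> / (2 * (real CARD('v))\<^sup>2)) * spread y"
proof -
  let ?n = "CARD('v)"
  obtain z S where z: "mono z" "\<And>i. z 0 \<le> y i" "\<And>i. y i \<le> z (?n - 1)"
    "\<And>d. d < ?n - 1 \<Longrightarrow> S d \<noteq> {}" "\<And>d. d < ?n - 1 \<Longrightarrow> S d \<noteq> UNIV"
    "\<And>d i. d < ?n - 1 \<Longrightarrow> i \<in> S d \<Longrightarrow> z (Suc d) \<le> y i"
    "\<And>d i. d < ?n - 1 \<Longrightarrow> i \<notin> S d \<Longrightarrow> y i \<le> z d"
    using sorted_cuts[of y] by metis
  let ?g = "\<lambda>d. (z (Suc d) - z d)\<^sup>2"
  define C where "C k = {d. d < ?n - 1 \<and> (\<exists>l<k. crosses (A (s + l)) (S d))}" for k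
  \<comment> \<open>The second conjunct is the invariant that cuts not yet crossed are still clean.\<close>
  have "\<zeta> / 2 * (\<Sum>d\<in>C k. ?g d) \<le> spread y - spread (mixes A s k y) \<and>
    (\<forall>d<?n - 1. d \<notin> C k \<longrightarrow> (\<forall>i. (i \<in> S d \<longrightarrow> z (Suc d) \<le> mixes A s k y i) \<and>
      (i \<notin> S d \<longrightarrow> mixes A s k y i \<le> z d)))" if "k \<le> Q" for k
    using that
  proof (induction k)
    case 0
    have "C 0 = {}" by (simp add: C_def)
    then show ?case using z by simp
  next
    case (Suc k)
    let ?y = "mixes A s k y" and ?A = "A (s + k)"
    let ?D = "C (Suc k) - C k"
    have ds: "doubly_stochastic ?A" and pa: "positive_above \<zeta> ?A" using A[of k] Suc.prems by auto
    have IH: "\<zeta> / 2 * (\<Sum>d\<in>C k. ?g d) \<le> spread y - spread ?y"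
      "\<And>d i. d < ?n - 1 \<Longrightarrow> d \<notin> C k \<Longrightarrow> i \<in> S d \<Longrightarrow> z (Suc d) \<le> ?y i"
      "\<And>d i. d < ?n - 1 \<Longrightarrow> d \<notin> C k \<Longrightarrow> i \<notin> S d \<Longrightarrow> ?y i \<le> z d"
      using Suc by auto
    have fin: "finite (C k)" for k by (simp add: C_def)
    have sub: "C k \<subseteq> C (Suc k)" by (auto simp: C_def less_Suc_eq)
    have "\<zeta> / 2 * (\<Sum>d\<in>?D. ?g d) \<le> spread ?y - spread (mix ?A ?y)"
    proof (rule spread_mix_crossed_cuts[OF ds pa z(1)])
      show "crosses ?A (S d)" if "d \<in> ?D" for d
        using that by (auto simp: C_def less_Suc_eq)
    qed (use fin IH in \<open>auto simp: C_def\<close>)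
    moreover have "(\<Sum>d\<in>C (Suc k). ?g d) = (\<Sum>d\<in>?D. ?g d) + (\<Sum>d\<in>C k. ?g d)"
      by (rule sum.subset_diff[OF sub fin])
    ultimately have 1: "\<zeta> / 2 * (\<Sum>d\<in>C (Suc k). ?g d) \<le> spread y - spread (mixes A s (Suc k) y)"
      using IH(1) by (simp add: distrib_left)
    have 2: "(i \<in> S d \<longrightarrow> z (Suc d) \<le> mix ?A ?y i) \<and> (i \<notin> S d \<longrightarrow> mix ?A ?y i \<le> z d)"
      if d: "d < ?n - 1" "d \<notin> C (Suc k)" for d i
    proof -
      have nc: "\<not> crosses ?A (S d)" and "d \<notin> C k" using d by (auto simp: C_def less_Suc_eq)
      then show ?thesis
        using mix_uncrossed(1)[OF ds nc, of i "z (Suc d)" ?y]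
          mix_uncrossed(2)[OF ds, of "- S d" i ?y "z d"] IH(2,3) d(1) by auto
    qed
    from 1 2 show ?case by simp
  qed
  from this[of Q] have 1: "\<zeta> / 2 * (\<Sum>d\<in>C Q. ?g d) \<le> spread y - spread (mixes A s Q y)" by simp
  have "C Q = {..<?n - 1}" using conn z(4,5) by (auto simp: C_def)
  moreover have "spread y \<le> (real ?n)\<^sup>2 * (\<Sum>d<?n - 1. ?g d)" by (rule spread_le_gaps[OF z(2,3)])
  ultimately have "spread y / (real ?n)\<^sup>2 \<le> (\<Sum>d\<in>C Q. ?g d)"
    by (simp add: field_simps)
  from mult_left_mono[OF this, of "\<zeta> / 2"] 1 \<zeta>
  have "\<zeta> / 2 * (spread y / (real ?n)\<^sup>2) \<le> spread y - spread (mixes A s Q y)" by linarith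
  then show ?thesis by (simp add: algebra_simps)
qed

section \<open>Vector-valued mixing\<close>

lemma spread_nonneg: "0 \<le> spread y"
  by (simp add: spread_def sum_nonneg)

lemma norm_deviation_le_spread: "norm (y i - agent_avg y) \<le> sqrt (spread y)"
  by (rule real_le_rsqrt) (auto simp: spread_def intro: member_le_sum)

lemma sqrt_spread_le_sum_norm:
  fixes y :: "'v::finite \<Rightarrow> 'a::real_inner"
  shows "sqrt (spread y) \<le> (\<Sum>i\<in>UNIV. norm (y i))"
proof (rule real_le_lsqrt)
  have "spread y \<le> (\<Sum>i\<in>UNIV. (norm (y i))\<^sup>2)"
    using sum_sq_deviation[of y 0] by simp
  also have "\<dots> \<le> (\<Sum>i\<in>UNIV. norm (y i) * (\<Sum>i\<in>UNIV. norm (y i)))"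
    unfolding power2_eq_square by (intro sum_mono mult_left_mono member_le_sum) auto
  finally show "spread y \<le> (\<Sum>i\<in>UNIV. norm (y i))\<^sup>2"
    by (simp add: sum_distrib_right power2_eq_square)
qed (auto intro: sum_nonneg)

lemma mix_add: "mix A (\<lambda>i. y i + w i) i = mix A y i + mix A w i"
  by (simp add: mix_def scaleR_add_right sum.distrib)

lemma mix_sum: "mix A (\<lambda>i. \<Sum>s\<in>I. y s i) i = (\<Sum>s\<in>I. mix A (y s) i)"
  unfolding mix_def scaleR_sum_right by (rule sum.swap)

lemma mix_inner: "mix A (\<lambda>i. y i \<bullet> b) i = mix A y i \<bullet> b"
  by (simp add: mix_def inner_sum_left)

text \<open>
  Mixing acts on each coordinate separately, which reduces vectors to real values.
\<close>

lemma mixes_inner: "mixes A s k (\<lambda>i. y i \<bullet> b) i = mixes A s k y i \<bullet> b"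
proof (induction k arbitrary: i)
  case (Suc k)
  have "mixes A s k (\<lambda>i. y i \<bullet> b) = (\<lambda>i. mixes A s k y i \<bullet> b)" by (rule ext) (rule Suc)
  then show ?case by (simp add: mix_inner)
qed simp

lemma mixes_add: "mixes A s (a + b) y = mixes A (s + a) b (mixes A s a y)"
  by (induction b) (simp_all add: add.assoc)

lemma spread_components:
  fixes y :: "'v::finite \<Rightarrow> 'a::euclidean_space"
  shows "spread y = (\<Sum>b\<in>Basis. spread (\<lambda>i. y i \<bullet> b))"
proof -
  have avg: "agent_avg (\<lambda>i. y i \<bullet> b) = agent_avg y \<bullet> b" for b
    by (simp add: agent_avg_def inner_sum_left)
  have "(norm (y i - agent_avg y))\<^sup>2 = (\<Sum>b\<in>Basis. (norm (y i \<bullet> b - agent_avg y \<bullet> b))\<^sup>2)" for i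
    by (subst power2_norm_eq_inner, subst euclidean_inner) (simp add: inner_diff_left power2_eq_square)
  then show ?thesis
    unfolding spread_def avg by (simp add: sum.swap[of _ UNIV Basis])
qed

lemma spread_mixes_block:
  fixes y :: "'v::finite \<Rightarrow> 'a::euclidean_space"
  assumes "\<And>k. k < Q \<Longrightarrow> doubly_stochastic (A (s + k))" "\<And>k. k < Q \<Longrightarrow> positive_above \<zeta> (A (s + k))"
    and "0 \<le> \<zeta>"
    and "\<And>S. S \<noteq> {} \<Longrightarrow> S \<noteq> UNIV \<Longrightarrow> \<exists>k<Q. crosses (A (s + k)) S"
  shows "spread (mixes A s Q y) \<le> (1 - \<zeta> / (2 * (real CARD('v))\<^sup>2)) * spread y"
  unfolding spread_components[of y] spread_components[of "mixes A s Q y"] sum_distrib_left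
    mixes_inner[symmetric]
  by (intro sum_mono spread_mixes_block_real assms)

lemma spread_mix_le:
  fixes y :: "'v::finite \<Rightarrow> 'a::euclidean_space"
  assumes A: "doubly_stochastic A"
  shows "spread (mix A y) \<le> spread y"
proof -
  have "spread (mix A (\<lambda>i. y i \<bullet> b)) \<le> spread (\<lambda>i. y i \<bullet> b)" for b
  proof -
    have "0 \<le> (\<Sum>k\<in>UNIV. \<Sum>i\<in>UNIV. \<Sum>j\<in>UNIV. A $ k $ i * A $ k $ j * (y i \<bullet> b - y j \<bullet> b)\<^sup>2)"
      using A by (intro sum_nonneg mult_nonneg_nonneg) (auto simp: doubly_stochastic_def)
    then show ?thesis using spread_mix[OF A, of "\<lambda>i. y i \<bullet> b"] by simp
  qed
  then show ?thesis
    unfolding spread_components[of y] spread_components[of "mix A y"] mix_inner[symmetric]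
    by (intro sum_mono)
qed

text \<open>
  Otherwise no path of the union graph could leave \<open>S\<close>.
\<close>

section \<open>Geometric decay of disagreement in the network\<close>

lemma strongly_connected_crossing_edge:
  assumes "strongly_connected (with_proj (union_graph E I))" and S: "S \<noteq> {}" "S \<noteq> UNIV"
  shows "\<exists>t\<in>I. \<exists>a b. (a, b) \<in> E t \<and> a \<in> S \<and> b \<notin> S"
proof (rule ccontr)
  assume none: "\<not> ?thesis"
  let ?G = "with_proj (union_graph E I)"
  obtain a b where ab: "a \<in> S" "b \<notin> S" using S by auto
  have "(a, b) \<in> rtrancl_on (verts ?G) (arcs_ends ?G)"
    using assms(1) by (auto simp: strongly_connected_def reachable_def union_graph_def)
  then have "b \<in> S"
  proof (induction rule: rtrancl_on_induct)
    case (step y z)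
    then show ?case using none by (auto simp: union_graph_def arcs_ends_def arc_to_ends_def)
  qed (use ab in auto)
  with ab show False by simp
qed

text \<open>
  Exchanging the two sums leaves, for each \<open>c s\<close>, a partial geometric series.
\<close>

section \<open>Mixing with disturbances\<close>

lemma sum_discounted_le:
  fixes c :: "nat \<Rightarrow> real"
  assumes r: "0 \<le> r" "r < 1" and c: "\<And>s. 0 \<le> c s"
  shows "(\<Sum>t<N. \<Sum>s\<le>t. r ^ (t - s) * c s) \<le> (\<Sum>s<N. c s) / (1 - r)"
proof -
  have "(\<Sum>t<N. \<Sum>s\<le>t. r ^ (t - s) * c s) = (\<Sum>(s, l)\<in>{(s, l). s + l < N}. r ^ l * c s)"
    by (rule sum.triangle_reindex[symmetric])
  also have "\<dots> \<le> (\<Sum>(s, l)\<in>{..<N} \<times> {..<N}. r ^ l * c s)"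
    by (rule sum_mono2) (use r c in auto)
  also have "\<dots> = (\<Sum>s<N. c s) * (\<Sum>l<N. r ^ l)"
    by (simp add: sum.cartesian_product[symmetric] sum_product mult.commute)
  also have "\<dots> \<le> (\<Sum>s<N. c s) * (1 / (1 - r))"
  proof (rule mult_left_mono)
    show "(\<Sum>l<N. r ^ l) \<le> 1 / (1 - r)"
      using r by (simp add: sum_gp_strict divide_right_mono)
  qed (use c in \<open>auto intro: sum_nonneg\<close>)
  finally show ?thesis by simp
qed

text \<open>
  The number \<open>\<beta>\<close> is the contraction factor of the
  square root of the spread over one aligned block, and \<open>\<sigma>\<close> is the corresponding factor per round.
\<close>

locale mixing_network =
  fixes E :: "nat \<Rightarrow> 'v::finite rel" and A :: "nat \<Rightarrow> real^'v^'v" and \<zeta> :: real and T Q :: nat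
    and \<beta> \<sigma> \<Gamma> :: real
  assumes weights: "\<And>t. t \<in> {1..T} \<Longrightarrow> compatible_weights (E t) (A t)"
    and T: "1 \<le> T"
    and zeta_pos: "\<zeta> > 0"
    and zeta: "\<And>t i k. t \<in> {1..T} \<Longrightarrow> A t $ i $ k > 0 \<Longrightarrow> A t $ i $ k > \<zeta>"
    and row_sums: "\<And>t i. t \<in> {1..T} \<Longrightarrow> (\<Sum>k\<in>UNIV. A t $ i $ k) = 1"
    and column_sums: "\<And>t k. t \<in> {1..T} \<Longrightarrow> (\<Sum>i\<in>UNIV. A t $ i $ k) = 1"
    and Q: "Q > 0"
    and connectivity: "\<And>k. strongly_connected (with_proj (union_graph E {k * Q + 1..(k + 1) * Q}))"
    and beta: "\<beta> = 1 - \<zeta> / (4 * (real CARD('v))\<^sup>2)"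
    and sigma: "\<sigma> = \<beta> powr (1 / real Q)"
    and Gamma: "\<Gamma> = \<beta> powr ((1 - 2 * real Q) / real Q)"
begin

lemma doubly_stochastic: "t \<in> {1..T} \<Longrightarrow> doubly_stochastic (A t)"
  using row_sums column_sums weights[of t] unfolding doubly_stochastic_def compatible_weights_def
  by (metis order.refl order_less_imp_le)

lemma positive_above: "t \<in> {1..T} \<Longrightarrow> positive_above \<zeta> (A t)"
  using zeta weights[of t] unfolding positive_above_def compatible_weights_def in_neighbors_def
  by (force intro: less_imp_le)

text \<open>
  An agent's own weight exceeds \<open>\<zeta>\<close> and is at most \<open>1\<close>, so \<open>\<zeta> < 1\<close>.
\<close>

lemma beta_bounds: "0 < \<beta>" "\<beta> < 1"
proof -
  fix i :: 'v
  have "1 \<in> {1..T}" using T by simp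
  then have "\<zeta> < A 1 $ i $ i"
    using zeta positive_above by (simp add: positive_above_def)
  moreover have "A 1 $ i $ i \<le> (\<Sum>k\<in>UNIV. A 1 $ i $ k)"
    using doubly_stochastic[OF \<open>1 \<in> {1..T}\<close>]
    by (intro member_le_sum) (auto simp: doubly_stochastic_def)
  ultimately have "\<zeta> < 1" using row_sums \<open>1 \<in> {1..T}\<close> by simp
  moreover have "1 \<le> (real CARD('v))\<^sup>2" by (simp add: Suc_leI)
  ultimately have "\<zeta> < 4 * (real CARD('v))\<^sup>2" by linarith
  then show "0 < \<beta>" by (simp add: beta)
  show "\<beta> < 1" using zeta_pos by (simp add: beta)
qed

lemma sigma_bounds: "0 < \<sigma>" "\<sigma> < 1"
  using beta_bounds Q powr_less_mono'[of \<beta> 0 "1 / real Q"] by (simp_all add: sigma)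

lemma Gamma_pos: "0 < \<Gamma>"
  using beta_bounds by (simp add: Gamma)

lemma crossing_in_block:
  assumes "(k + 1) * Q \<le> T" "S \<noteq> {}" "S \<noteq> UNIV"
  shows "\<exists>l<Q. crosses (A (k * Q + 1 + l)) S"
proof -
  obtain t a b where t: "t \<in> {k * Q + 1..(k + 1) * Q}" and ab: "(a, b) \<in> E t" "a \<in> S" "b \<notin> S"
    using strongly_connected_crossing_edge[OF connectivity assms(2,3)] by blast
  have "A t $ b $ a > 0"
    using weights[of t] t ab assms(1) by (auto simp: compatible_weights_def in_neighbors_def)
  then have "crosses (A t) S" using ab by (auto simp: crosses_def)
  moreover have "t = k * Q + 1 + (t - (k * Q + 1))" "t - (k * Q + 1) < Q" using t Q by auto
  ultimately show ?thesis by metis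
qed

lemma spread_aligned_block:
  fixes y :: "'v \<Rightarrow> 'a::euclidean_space"
  assumes "(k + 1) * Q \<le> T"
  shows "spread (mixes A (k * Q + 1) Q y) \<le> \<beta>\<^sup>2 * spread y"
proof -
  have "spread (mixes A (k * Q + 1) Q y) \<le> (1 - \<zeta> / (2 * (real CARD('v))\<^sup>2)) * spread y"
    by (rule spread_mixes_block)
      (use assms doubly_stochastic positive_above zeta_pos crossing_in_block[OF assms] in auto)
  \<comment> \<open>Passing to the square root of the spread turns \<open>2 n\<^sup>2\<close> into \<open>4 n\<^sup>2\<close>, since \<open>1 - 2 q \<le> (1 - q)\<^sup>2\<close>.\<close>
  also have "1 - \<zeta> / (2 * (real CARD('v))\<^sup>2) \<le> \<beta>\<^sup>2"
    by (simp add: beta power2_diff field_simps)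
  finally show ?thesis by (simp add: mult_right_mono spread_nonneg)
qed

lemma spread_mixes_le:
  fixes y :: "'v \<Rightarrow> 'a::euclidean_space"
  assumes "1 \<le> s" "s + k \<le> Suc T"
  shows "spread (mixes A s k y) \<le> spread y"
  using assms(2)
proof (induction k)
  case (Suc k)
  then show ?case
    using spread_mix_le[OF doubly_stochastic, of "s + k" "mixes A s k y"] assms(1) by simp
qed simp

lemma spread_aligned_blocks:
  fixes y :: "'v \<Rightarrow> 'a::euclidean_space"
  assumes "(k + m) * Q \<le> T"
  shows "spread (mixes A (k * Q + 1) (m * Q) y) \<le> (\<beta> ^ m)\<^sup>2 * spread y"
  using assms
proof (induction m)
  case (Suc m)
  have "spread (mixes A (k * Q + 1) (Suc m * Q) y)
      = spread (mixes A ((k + m) * Q + 1) Q (mixes A (k * Q + 1) (m * Q) y))"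
    using mixes_add[of A "k * Q + 1" "m * Q" Q y] by (simp add: algebra_simps)
  also have "\<dots> \<le> \<beta>\<^sup>2 * spread (mixes A (k * Q + 1) (m * Q) y)"
    by (rule spread_aligned_block) (use Suc.prems in \<open>simp add: algebra_simps\<close>)
  also have "\<dots> \<le> \<beta>\<^sup>2 * ((\<beta> ^ m)\<^sup>2 * spread y)"
    using Suc by (intro mult_left_mono) auto
  finally show ?case by (simp add: power_mult_distrib mult.assoc)
qed simp

text \<open>
  A window of \<open>L\<close> rounds loses fewer than \<open>Q\<close> rounds at its start until the next block begins and
  fewer than \<open>Q\<close> rounds after its last complete block. So it contains at least \<open>L / Q - 2\<close> complete
  blocks; the remaining rounds do no harm.
\<close>

lemma spread_mixes_decay:
  fixes y :: "'v \<Rightarrow> 'a::euclidean_space"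
  assumes s: "1 \<le> s" "s + L \<le> Suc T"
  shows "sqrt (spread (mixes A s L y)) \<le> \<beta> powr (real L / real Q - 2) * sqrt (spread y)"
proof (cases "L < 2 * Q")
  case True
  then have "real L / real Q - 2 \<le> 0" using Q by (simp add: field_simps)
  then have "1 \<le> \<beta> powr (real L / real Q - 2)"
    using beta_bounds powr_mono'[of "real L / real Q - 2" 0 \<beta>] by simp
  then have "1 * sqrt (spread y) \<le> \<beta> powr (real L / real Q - 2) * sqrt (spread y)"
    by (rule mult_right_mono) (simp add: spread_nonneg)
  moreover have "sqrt (spread (mixes A s L y)) \<le> sqrt (spread y)"
    using spread_mixes_le[OF s] by simp
  ultimately show ?thesis by linarith
next
  case False
  \<comment> \<open>Block \<open>k\<close> is the first one that starts at or after round \<open>s\<close>, and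
     \<open>r\<close> rounds precede it; \<open>m\<close> complete blocks and \<open>e\<close> further rounds follow.\<close>
  define k where "k = (s - 1 + (Q - 1)) div Q"
  define r where "r = k * Q - (s - 1)"
  define m where "m = (L - r) div Q"
  define e where "e = (L - r) mod Q"
  have kQ: "s - 1 + (Q - 1) = k * Q + (s - 1 + (Q - 1)) mod Q" "(s - 1 + (Q - 1)) mod Q < Q"
    using Q by (simp_all add: k_def)
  then have "s - 1 \<le> k * Q" "k * Q \<le> s - 1 + (Q - 1)" by linarith+
  then have r: "s + r = k * Q + 1" "r < Q" using s Q by (auto simp: r_def)
  have L: "L = r + (m * Q + e)" "e < Q"
    using r False Q by (simp_all add: m_def e_def)
  let ?y1 = "mixes A s r y"
  let ?y2 = "mixes A (k * Q + 1) (m * Q) ?y1"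
  have "mixes A s L y = mixes A (k * Q + 1 + m * Q) e ?y2"
    unfolding L(1) mixes_add r(1) by simp
  then have "spread (mixes A s L y) \<le> spread ?y2"
    using spread_mixes_le[of "k * Q + 1 + m * Q" e ?y2] s r(1) L by simp
  also have "\<dots> \<le> (\<beta> ^ m)\<^sup>2 * spread ?y1"
    by (rule spread_aligned_blocks) (use s r(1) L in \<open>simp add: algebra_simps\<close>)
  also have "\<dots> \<le> (\<beta> ^ m)\<^sup>2 * spread y"
    by (intro mult_left_mono spread_mixes_le) (use s L in auto)
  finally have "sqrt (spread (mixes A s L y)) \<le> sqrt ((\<beta> ^ m)\<^sup>2 * spread y)" by simp
  also have "\<dots> = \<beta> ^ m * sqrt (spread y)"
    using beta_bounds by (simp add: real_sqrt_mult)
  also have "\<beta> ^ m \<le> \<beta> powr (real L / real Q - 2)"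
  proof -
    have "L \<le> m * Q + 2 * Q" using L r by simp
    then have "real L \<le> real m * real Q + 2 * real Q"
      by (metis of_nat_add of_nat_le_iff of_nat_mult of_nat_numeral)
    then have "real L / real Q - 2 \<le> real m" using Q by (simp add: field_simps)
    then have "\<beta> powr real m \<le> \<beta> powr (real L / real Q - 2)"
      using beta_bounds by (intro powr_mono') auto
    then show ?thesis using beta_bounds by (simp add: powr_realpow)
  qed
  finally show ?thesis by (simp add: mult_right_mono spread_nonneg)
qed

lemma agent_avg_mixes:
  assumes "1 \<le> s" "s + k \<le> Suc T"
  shows "agent_avg (mixes A s k y) = agent_avg y"
  using assms(2)
proof (induction k)
  case (Suc k)
  then show ?case
    using agent_avg_mix[OF doubly_stochastic, of "s + k" "mixes A s k y"] assms(1) by simp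
qed simp

text \<open>
  The exponent \<open>(1 - 2 Q) / Q\<close> in \<open>\<Gamma>\<close> is \<open>L / Q - 2\<close> at \<open>L = 1\<close>; every further round contributes the
  factor \<open>\<sigma>\<close>.
\<close>

lemma deviation_mixes_le:
  fixes y :: "'v \<Rightarrow> 'a::euclidean_space"
  assumes s: "1 \<le> s" "s + l \<le> T"
  shows "norm (mixes A s (Suc l) y i - agent_avg y) \<le> \<Gamma> * \<sigma> ^ l * (\<Sum>j\<in>UNIV. norm (y j))"
proof -
  have s': "1 \<le> s" "s + Suc l \<le> Suc T" using s by auto
  have "norm (mixes A s (Suc l) y i - agent_avg y) \<le> sqrt (spread (mixes A s (Suc l) y))"
    using norm_deviation_le_spread[of "mixes A s (Suc l) y" i] unfolding agent_avg_mixes[OF s'] .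
  also have "\<dots> \<le> \<beta> powr (real (Suc l) / real Q - 2) * sqrt (spread y)"
    by (rule spread_mixes_decay[OF s'])
  also have "\<dots> \<le> \<beta> powr (real (Suc l) / real Q - 2) * (\<Sum>j\<in>UNIV. norm (y j))"
    by (intro mult_left_mono sqrt_spread_le_sum_norm) simp
  also have "\<beta> powr (real (Suc l) / real Q - 2) = \<Gamma> * \<sigma> ^ l"
  proof -
    have "\<sigma> ^ l = \<beta> powr (real l / real Q)"
      using beta_bounds by (simp add: sigma powr_realpow[symmetric] powr_powr)
    moreover have "real (Suc l) / real Q - 2 = (1 - 2 * real Q) / real Q + real l / real Q"
      using Q by (simp add: field_simps)
    ultimately show ?thesis by (simp add: Gamma powr_add)
  qed
  finally show ?thesis .
qed

text \<open>
  By linearity each disturbance evolves independently: \<open>u s\<close> enters before round \<open>Suc s\<close> and is mixed in all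
  rounds from there on. Starting at \<open>z 0 = 0\<close> makes the initial state the disturbance \<open>u 0\<close>.
\<close>

lemma driven_mixing_unroll:
  fixes z u :: "nat \<Rightarrow> 'v \<Rightarrow> 'a::real_vector"
  assumes "\<And>i. z 0 i = 0" "\<And>t i. t < T \<Longrightarrow> z (Suc t) i = mix (A (Suc t)) (\<lambda>k. z t k + u t k) i"
    and "t \<le> T"
  shows "z t i = (\<Sum>s<t. mixes A (Suc s) (t - s) (u s) i)"
  using assms(3)
proof (induction t arbitrary: i)
  case 0
  then show ?case by (simp add: assms(1))
next
  case (Suc t)
  have "z t = (\<lambda>k. \<Sum>s<t. mixes A (Suc s) (t - s) (u s) k)" using Suc by auto
  then have "z (Suc t) i = (\<Sum>s<t. mix (A (Suc t)) (mixes A (Suc s) (t - s) (u s)) i) + mix (A (Suc t)) (u t) i"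
    using Suc.prems by (simp add: assms(2) mix_add mix_sum)
  also have "(\<Sum>s<t. mix (A (Suc t)) (mixes A (Suc s) (t - s) (u s)) i)
      = (\<Sum>s<t. mixes A (Suc s) (Suc t - s) (u s) i)"
    by (rule sum.cong) (auto simp: Suc_diff_le)
  finally show ?case by simp
qed

text \<open>
  The disturbance \<open>u s\<close> is visible in \<open>z (Suc t)\<close> with a deviation of at most \<open>\<Gamma> \<sigma>\<^bsup>t - s\<^esup>\<close> times its size;
  summing the geometric series over \<open>t\<close> gives a bound in which the disturbances enter only by their total
  size.
\<close>

lemma driven_mixing_deviation_sum:
  fixes z u :: "nat \<Rightarrow> 'v \<Rightarrow> 'a::euclidean_space"
  assumes z: "\<And>i. z 0 i = 0" "\<And>t i. t < T \<Longrightarrow> z (Suc t) i = mix (A (Suc t)) (\<lambda>k. z t k + u t k) i"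
  shows "(\<Sum>t=1..T. norm (z t i - agent_avg (z t))) \<le> \<Gamma> / (1 - \<sigma>) * (\<Sum>s<T. \<Sum>j\<in>UNIV. norm (u s j))"
proof -
  have dev: "norm (z (Suc t) i - agent_avg (z (Suc t)))
      \<le> (\<Sum>s\<le>t. \<sigma> ^ (t - s) * (\<Gamma> * (\<Sum>j\<in>UNIV. norm (u s j))))" if t: "t < T" for t
  proof -
    have unroll: "z (Suc t) k = (\<Sum>s\<le>t. mixes A (Suc s) (Suc (t - s)) (u s) k)" for k
      using driven_mixing_unroll[of z u "Suc t" k] z t
      by (simp add: lessThan_Suc_atMost Suc_diff_le del: mixes.simps(2) cong: sum.cong_simp)
    have "agent_avg (z (Suc t)) = (\<Sum>s\<le>t. agent_avg (mixes A (Suc s) (Suc (t - s)) (u s)))"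
      unfolding agent_avg_def unroll by (subst sum.swap) (simp add: scaleR_sum_right del: mixes.simps(2))
    also have "\<dots> = (\<Sum>s\<le>t. agent_avg (u s))"
      by (rule sum.cong[OF refl], rule agent_avg_mixes) (use t in auto)
    finally have "z (Suc t) i - agent_avg (z (Suc t))
        = (\<Sum>s\<le>t. mixes A (Suc s) (Suc (t - s)) (u s) i - agent_avg (u s))"
      by (simp add: unroll sum_subtractf del: mixes.simps(2))
    also have "norm \<dots> \<le> (\<Sum>s\<le>t. \<Gamma> * \<sigma> ^ (t - s) * (\<Sum>j\<in>UNIV. norm (u s j)))"
      by (rule order_trans[OF norm_sum sum_mono], rule deviation_mixes_le) (use t in auto)
    finally show ?thesis by (simp add: mult_ac)
  qed
  have "(\<Sum>t=1..T. norm (z t i - agent_avg (z t))) = (\<Sum>t<T. norm (z (Suc t) i - agent_avg (z (Suc t))))"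
    by (rule sum.reindex_bij_witness[of _ Suc "\<lambda>t. t - 1"]) auto
  also have "\<dots> \<le> (\<Sum>t<T. \<Sum>s\<le>t. \<sigma> ^ (t - s) * (\<Gamma> * (\<Sum>j\<in>UNIV. norm (u s j))))"
    by (rule sum_mono, rule dev) simp
  also have "\<dots> \<le> (\<Sum>s<T. \<Gamma> * (\<Sum>j\<in>UNIV. norm (u s j))) / (1 - \<sigma>)"
    using sigma_bounds Gamma_pos by (intro sum_discounted_le mult_nonneg_nonneg sum_nonneg) auto
  finally show ?thesis by (simp add: sum_distrib_left[symmetric])
qed

end

section \<open>Gradients of convex and smooth functions\<close>

lemma GDERIV_along_segment:
  assumes "GDERIV f (x + s *\<^sub>R d) :> g"
  shows "((\<lambda>s. f (x + s *\<^sub>R d)) has_real_derivative g \<bullet> d) (at s)"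
proof -
  have "((\<lambda>s. x + s *\<^sub>R d) has_derivative (\<lambda>h. h *\<^sub>R d)) (at s)"
    by (auto intro!: derivative_eq_intros)
  from diff_chain_at[OF this assms[unfolded gderiv_def]]
  show ?thesis by (simp add: has_field_derivative_def o_def inner_commute mult_commute_abs)
qed

lemma segment_in_convex:
  assumes "convex X" "x \<in> X" "y \<in> X" "0 \<le> s" "s \<le> (1::real)"
  shows "x + s *\<^sub>R (y - x) \<in> X"
  using convexD_alt[OF assms] by (simp add: algebra_simps)

text \<open>
  The difference quotients of \<open>f\<close> along the segment are at most \<open>f y - f x\<close>, hence so is their limit. Only points
  of \<open>X\<close> are evaluated, so \<open>x\<close> may lie on the boundary.
\<close>

lemma convex_on_gradient_le:
  assumes f: "convex_on X f" and xy: "x \<in> X" "y \<in> X" and g: "GDERIV f x :> g"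
  shows "f x + g \<bullet> (y - x) \<le> f y"
proof -
  let ?\<phi> = "\<lambda>s. f (x + s *\<^sub>R (y - x))"
  have "(?\<phi> has_real_derivative g \<bullet> (y - x)) (at 0)"
    by (rule GDERIV_along_segment) (use g in simp)
  then have "((\<lambda>s. (?\<phi> s - f x) / s) \<longlongrightarrow> g \<bullet> (y - x)) (at_right 0)"
    by (auto simp: DERIV_def intro: filterlim_at_split[THEN iffD1, THEN conjunct2])
  moreover have "\<forall>\<^sub>F s in at_right 0. (?\<phi> s - f x) / s \<le> f y - f x"
    unfolding eventually_at_right_field
  proof (intro exI[of _ 1] conjI allI impI)
    fix s :: real assume s: "0 < s" "s < 1"
    have "?\<phi> s \<le> (1 - s) * f x + s * f y"
      using convex_onD[OF f, of s x y] s xy by (simp add: algebra_simps)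
    then show "(?\<phi> s - f x) / s \<le> f y - f x" using s by (simp add: field_simps)
  qed simp
  ultimately have "g \<bullet> (y - x) \<le> f y - f x"
    by (rule tendsto_upperbound) simp
  then show ?thesis by simp
qed

text \<open>
  The difference of \<open>f\<close> along the segment and the claimed upper bound has derivative \<open>\<le> 0\<close>, by the
  Lipschitz bound for the gradient and the inequality of Cauchy and Schwarz.
\<close>

lemma lipschitz_gradient_upper_bound:
  assumes X: "convex X" and xy: "x \<in> X" "y \<in> X"
    and g: "\<And>z. z \<in> X \<Longrightarrow> GDERIV f z :> g z" and G: "G-lipschitz_on X g"
  shows "f y \<le> f x + g x \<bullet> (y - x) + G / 2 * (norm (y - x))\<^sup>2"
proof -
  let ?d = "y - x"
  let ?\<psi> = "\<lambda>s. f (x + s *\<^sub>R ?d) - s * (g x \<bullet> ?d) - G / 2 * (norm ?d)\<^sup>2 * s\<^sup>2"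
  have "?\<psi> 1 \<le> ?\<psi> 0"
  proof (rule DERIV_nonpos_imp_nonincreasing[of 0 1 ?\<psi>])
    fix s :: real assume s: "0 \<le> s" "s \<le> 1"
    let ?p = "x + s *\<^sub>R ?d"
    have p: "?p \<in> X" by (rule segment_in_convex[OF X xy s])
    have "(?\<psi> has_real_derivative g ?p \<bullet> ?d - g x \<bullet> ?d - G / 2 * (norm ?d)\<^sup>2 * (2 * s)) (at s)"
      using GDERIV_along_segment[OF g[OF p]] by (auto intro!: derivative_eq_intros)
    moreover have "g ?p \<bullet> ?d - g x \<bullet> ?d - G / 2 * (norm ?d)\<^sup>2 * (2 * s) \<le> 0"
    proof -
      have "(g ?p - g x) \<bullet> ?d \<le> norm (g ?p - g x) * norm ?d" by (rule norm_cauchy_schwarz)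
      also have "\<dots> \<le> (G * (s * norm ?d)) * norm ?d"
        using lipschitz_onD[OF G p xy(1)] s by (intro mult_right_mono) (auto simp: dist_norm)
      finally show ?thesis by (simp add: inner_diff_left power2_eq_square mult_ac)
    qed
    ultimately show "\<exists>y. (?\<psi> has_real_derivative y) (at s) \<and> y \<le> 0" by blast
  qed simp
  then show ?thesis by simp
qed

section \<open>Frank-Wolfe steps of an average\<close>

lemma agent_avg_in_convex:
  assumes "convex X" "\<And>i. y i \<in> X"
  shows "agent_avg y \<in> X"
  unfolding agent_avg_def scaleR_sum_right
  by (rule convex_sum) (use assms in auto)

lemma mix_in_convex:
  assumes "doubly_stochastic A" "convex X" "\<And>i. y i \<in> X"
  shows "mix A y i \<in> X"
  unfolding mix_def by (rule convex_sum) (use assms in \<open>auto simp: doubly_stochastic_def\<close>)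

text \<open>
  With the exact direction \<open>gF a / n\<close> in place of \<open>g i\<close>, the minimiser \<open>w i\<close> would satisfy
  \<open>gF a \<bullet> (w i - a) \<le> gF a \<bullet> (c - a) \<le> F c - F a\<close>. Since \<open>w i\<close> minimises along \<open>g i\<close>, the error of the
  direction is paired with \<open>w i - c\<close> only and costs at most \<open>M\<close> times its norm.
\<close>

lemma frank_wolfe_averaged_step:
  fixes F :: "'a::real_inner \<Rightarrow> real" and w g :: "'v::finite \<Rightarrow> 'a"
  assumes X: "convex X" and F: "convex_on X F" and gF: "\<And>z. z \<in> X \<Longrightarrow> GDERIV F z :> gF z"
    and K: "K-lipschitz_on X gF"
    and M: "\<And>p q. p \<in> X \<Longrightarrow> q \<in> X \<Longrightarrow> norm (p - q) \<le> M"
    and a: "a \<in> X" and c: "c \<in> X"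
    and w: "\<And>i. is_arg_min (\<lambda>p. p \<bullet> g i) (\<lambda>p. p \<in> X) (w i)"
    and \<alpha>: "0 \<le> \<alpha>" "\<alpha> \<le> 1"
  shows "F (a + \<alpha> *\<^sub>R (agent_avg w - a)) \<le> F a - \<alpha> * (F a - F c)
    + \<alpha> * M * (\<Sum>i\<in>UNIV. norm ((1 / real CARD('v)) *\<^sub>R gF a - g i)) + K / 2 * (\<alpha> * M)\<^sup>2"
proof -
  let ?n = "real CARD('v)"
  define h where "h = (1 / ?n) *\<^sub>R gF a"
  let ?a' = "a + \<alpha> *\<^sub>R (agent_avg w - a)"
  have wX: "w i \<in> X" and wmin: "\<And>p. p \<in> X \<Longrightarrow> w i \<bullet> g i \<le> p \<bullet> g i" for i
    using w[of i] by (auto simp: is_arg_min_linorder)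
  have avgX: "agent_avg w \<in> X" using X wX by (rule agent_avg_in_convex)
  have step: "norm (?a' - a) \<le> \<alpha> * M"
    using M[OF avgX a] \<alpha> by (simp add: mult_left_mono)
  have i: "h \<bullet> (w i - a) \<le> M * norm (h - g i) + h \<bullet> (c - a)" for i
  proof -
    have "(h - g i) \<bullet> (w i - c) \<le> norm (h - g i) * norm (w i - c)" by (rule norm_cauchy_schwarz)
    also have "\<dots> \<le> norm (h - g i) * M" by (intro mult_left_mono M wX c) simp
    finally show ?thesis
      using wmin[OF c, of i] by (simp add: inner_diff_left inner_diff_right inner_commute mult.commute)
  qed
  have "gF a \<bullet> (agent_avg w - a) = (\<Sum>i\<in>UNIV. h \<bullet> (w i - a))"
    by (simp add: h_def agent_avg_def inner_sum_right inner_diff_right sum_subtractf sum_divide_distrib)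
  also have "\<dots> \<le> (\<Sum>i\<in>UNIV. M * norm (h - g i) + h \<bullet> (c - a))" by (rule sum_mono) (rule i)
  also have "\<dots> = M * (\<Sum>i\<in>UNIV. norm (h - g i)) + gF a \<bullet> (c - a)"
    by (simp add: h_def sum.distrib sum_distrib_left)
  also have "gF a \<bullet> (c - a) \<le> F c - F a"
    using convex_on_gradient_le[OF F a c gF[OF a]] by simp
  finally have lin: "gF a \<bullet> (agent_avg w - a) \<le> M * (\<Sum>i\<in>UNIV. norm (h - g i)) + (F c - F a)" by simp
  have "F ?a' \<le> F a + gF a \<bullet> (?a' - a) + K / 2 * (norm (?a' - a))\<^sup>2"
    by (rule lipschitz_gradient_upper_bound[OF X a segment_in_convex[OF X a avgX \<alpha>] gF K])
  also have "K / 2 * (norm (?a' - a))\<^sup>2 \<le> K / 2 * (\<alpha> * M)\<^sup>2"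
    by (intro mult_left_mono power_mono step) (use lipschitz_on_nonneg[OF K] in auto)
  finally show ?thesis
    using mult_left_mono[OF lin \<alpha>(1)] by (simp add: h_def algebra_simps)
qed

text \<open>
  The variation \<open>h\<close> is paid twice: once when the sum telescopes, because the functions change along the way, and
  once to move the last value from \<open>F (Suc N)\<close> back to \<open>F 1\<close>. After that both values belong to the same function and a
  Lipschitz bound can compare them.
\<close>

lemma telescoping_varying_function:
  fixes F :: "nat \<Rightarrow> 'a \<Rightarrow> real"
  assumes X: "\<And>t. t \<in> {1..Suc N} \<Longrightarrow> a t \<in> X"
    and h: "\<And>t y. t \<in> {1..N} \<Longrightarrow> y \<in> X \<Longrightarrow> \<bar>F (Suc t) y - F t y\<bar> \<le> h t"
  shows "(\<Sum>t=1..N. F t (a t) - F t (a (Suc t))) \<le> F 1 (a 1) - F 1 (a (Suc N)) + 2 * (\<Sum>t=1..N. h t)"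
proof -
  have 1: "(\<Sum>t=1..m. F t (a t) - F t (a (Suc t))) \<le> F 1 (a 1) - F (Suc m) (a (Suc m)) + (\<Sum>t=1..m. h t)"
    if "m \<le> N" for m
    using that
  proof (induction m)
    case (Suc m)
    then show ?case using h[of "Suc m" "a (Suc (Suc m))"] X[of "Suc (Suc m)"] by auto
  qed simp
  have 2: "F 1 y \<le> F (Suc m) y + (\<Sum>t=1..m. h t)" if "m \<le> N" "y \<in> X" for m y
    using that
  proof (induction m)
    case (Suc m)
    then show ?case using h[of "Suc m" y] by auto
  qed simp
  show ?thesis using 1[of N] 2[of N "a (Suc N)"] X[of "Suc N"] by simp
qed

section \<open>Runs of the algorithm\<close>

lemma le_Max_SUP:
  fixes h :: "'v::finite \<Rightarrow> 'a \<Rightarrow> real"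
  assumes "bdd_above (h i ` X)" "y \<in> X"
  shows "h i y \<le> (MAX i. SUP y\<in>X. h i y)"
proof -
  have "h i y \<le> (SUP y\<in>X. h i y)" by (rule cSUP_upper[OF assms(2,1)])
  also have "\<dots> \<le> (MAX i. SUP y\<in>X. h i y)" by (rule Max_ge) auto
  finally show ?thesis .
qed

lemma sum_UNIV_le_card: "(\<And>i. h i \<le> B) \<Longrightarrow> (\<Sum>i\<in>(UNIV::'v::finite set). h i) \<le> real CARD('v) * B"
  by (rule sum_bounded_above) auto

lemma sum_from_1_split:
  fixes h :: "nat \<Rightarrow> 'a::comm_monoid_add"
  assumes "1 \<le> N"
  shows "(\<Sum>t=1..N. h t) = h 1 + (\<Sum>t=1..<N. h (Suc t))"
  using assms by (induction N rule: nat_induct_at_least) (simp_all add: add.assoc)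

lemma norm_diff_triangle3:
  "norm (a - b) \<le> norm (a - c) + norm (c - d) + norm (d - b :: 'a::real_normed_vector)"
  using norm_triangle_ineq[of "a - c" "c - b"] norm_triangle_ineq[of "c - d" "d - b"] by simp

locale dofw_run = mixing_network E A \<zeta> T Q \<beta> \<sigma> \<Gamma>
  for E :: "nat \<Rightarrow> 'v::finite rel" and A :: "nat \<Rightarrow> real^'v^'v" and \<zeta> :: real and T Q :: nat
    and \<beta> \<sigma> \<Gamma> :: real +
  fixes X :: "'a::euclidean_space set"
    and f :: "'v \<Rightarrow> nat \<Rightarrow> 'a \<Rightarrow> real"
    and grad :: "'v \<Rightarrow> nat \<Rightarrow> 'a \<Rightarrow> 'a"
    and xstar :: "nat \<Rightarrow> 'a"
    and x xh gb gh v :: "'v \<Rightarrow> nat \<Rightarrow> 'a"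
    and \<alpha> M L G :: real
  assumes X: "X \<noteq> {}" "convex X" "compact X"
    and loss_convex: "\<And>i t. t \<ge> 1 \<Longrightarrow> convex_on X (f i t)"
    and loss_gradient: "\<And>i t y. t \<ge> 1 \<Longrightarrow> y \<in> X \<Longrightarrow> GDERIV (f i t) y :> grad i t y"
    and comparator: "\<And>t. t \<ge> 1 \<Longrightarrow> xstar t \<in> X"
    and alpha: "0 < \<alpha>" "\<alpha> \<le> 1"
    and algorithm: "dofw_co X grad E A \<alpha> T x xh gb gh v"
    and diameter: "\<And>y z. y \<in> X \<Longrightarrow> z \<in> X \<Longrightarrow> norm (y - z) \<le> M"
    and loss_lipschitz: "\<And>i t. t \<ge> 1 \<Longrightarrow> L-lipschitz_on X (f i t)"
    and gradient_lipschitz: "\<And>i t. t \<ge> 1 \<Longrightarrow> G-lipschitz_on X (grad i t)"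
begin

abbreviation x_avg :: "nat \<Rightarrow> 'a" where "x_avg t \<equiv> agent_avg (\<lambda>i. x i t)"

abbreviation gap_factor :: real where "gap_factor \<equiv> \<Gamma> / (1 - \<sigma>)"

lemma sum_in_neighbors:
  assumes "t \<in> {1..T}"
  shows "(\<Sum>k\<in>in_neighbors (E t) i. A t $ i $ k *\<^sub>R y k) = mix (A t) y i"
  unfolding mix_def
  by (rule sum.mono_neutral_left) (use weights[OF assms] in \<open>auto simp: compatible_weights_def\<close>)

lemma start: "x i 1 \<in> X"
  using algorithm by (simp add: dofw_co_def)

lemma xh_eq: "t \<in> {1..T} \<Longrightarrow> xh i t = mix (A t) (\<lambda>k. x k t) i"
  using algorithm unfolding dofw_co_def sum_in_neighbors[symmetric] by blast

lemma gh_eq: "t \<in> {1..T} \<Longrightarrow> gh i t = mix (A t) (\<lambda>k. gb k t) i"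
  using algorithm unfolding dofw_co_def sum_in_neighbors[symmetric] by blast

lemma v_min: "t \<in> {1..T} \<Longrightarrow> is_arg_min (\<lambda>y. y \<bullet> gh i t) (\<lambda>y. y \<in> X) (v i t)"
  using algorithm unfolding dofw_co_def by blast

lemma x_Suc: "t \<in> {1..T} \<Longrightarrow> x i (Suc t) = xh i t + \<alpha> *\<^sub>R (v i t - xh i t)"
  using algorithm unfolding dofw_co_def Suc_eq_plus1 by blast

lemma gb_1: "gb i 1 = grad i 1 (xh i 1)"
  using algorithm T by (simp add: dofw_co_def)

lemma gb_Suc: "t \<in> {1..<T} \<Longrightarrow>
    gb i (Suc t) = gh i t + (grad i (Suc t) (xh i (Suc t)) - grad i t (xh i t))"
  using algorithm by (auto simp: dofw_co_def)

lemma v_in: "t \<in> {1..T} \<Longrightarrow> v i t \<in> X"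
  using v_min[of t i] by (simp add: is_arg_min_linorder)

lemma x_in: "t \<in> {1..Suc T} \<Longrightarrow> x i t \<in> X"
proof (induction t arbitrary: i)
  case (Suc t)
  show ?case
  proof (cases "t = 0")
    case False
    then have t: "t \<in> {1..T}" using Suc.prems by auto
    then have "xh i t \<in> X"
      unfolding xh_eq[OF t] using Suc.IH by (intro mix_in_convex doubly_stochastic X) auto
    then show ?thesis
      unfolding x_Suc[OF t] using alpha by (intro segment_in_convex X v_in t) auto
  qed (use start in simp)
qed simp

lemma xh_in: "t \<in> {1..T} \<Longrightarrow> xh i t \<in> X"
  by (subst xh_eq) (auto intro!: mix_in_convex doubly_stochastic X x_in)

lemma x_avg_in: "t \<in> {1..Suc T} \<Longrightarrow> x_avg t \<in> X"
  by (intro agent_avg_in_convex X x_in)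

lemma agent_avg_xh:
  assumes "t \<in> {1..T}"
  shows "agent_avg (\<lambda>i. xh i t) = x_avg t"
  using agent_avg_mix[OF doubly_stochastic[OF assms], of "\<lambda>k. x k t"]
  by (simp add: xh_eq[OF assms])

text \<open>
  The average itself makes a Frank-Wolfe step, because mixing preserves averages.
\<close>

lemma x_avg_Suc:
  assumes "t \<in> {1..T}"
  shows "x_avg (Suc t) = x_avg t + \<alpha> *\<^sub>R (agent_avg (\<lambda>i. v i t) - x_avg t)"
  using agent_avg_xh[OF assms]
  by (simp add: x_Suc[OF assms] agent_avg_def sum.distrib sum_subtractf scaleR_add_right
      scaleR_diff_right scaleR_sum_right[symmetric] scaleR_left_commute)

lemma M_nonneg: "0 \<le> M"
  using diameter[OF start start] by (metis norm_ge_zero order_trans)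

lemma step_norm:
  assumes "t \<in> {1..T}"
  shows "norm (\<alpha> *\<^sub>R (v i t - xh i t)) \<le> \<alpha> * M"
  using diameter[OF v_in[OF assms] xh_in[OF assms]] alpha by (simp add: mult_left_mono)

lemma x_avg_step:
  assumes "t \<in> {1..T}"
  shows "norm (x_avg (Suc t) - x_avg t) \<le> \<alpha> * M"
proof -
  have "norm (agent_avg (\<lambda>i. v i t) - x_avg t) \<le> M"
    using assms by (intro diameter agent_avg_in_convex X v_in x_in) auto
  then show ?thesis unfolding x_avg_Suc[OF assms] using alpha by (simp add: mult_left_mono)
qed

lemma G_nonneg: "0 \<le> G"
  using gradient_lipschitz[of 1 undefined] lipschitz_on_nonneg by blast

lemma gap_factor_nonneg: "0 \<le> gap_factor"
  using Gamma_pos sigma_bounds by simp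

text \<open>
  The mixed iterates form a mixing process that is disturbed by the steps, each of norm at most \<open>\<alpha> * M\<close>.
\<close>

section \<open>Consensus error of the iterates\<close>

lemma sum_xh_deviation:
  "(\<Sum>t=1..T. norm (xh i t - x_avg t))
    \<le> gap_factor * ((\<Sum>j\<in>UNIV. norm (x j 1)) + real CARD('v) * \<alpha> * M * real T)"
proof -
  define z where "z t i = (if t = 0 then 0 else xh i t)" for t i
  define u where "u t i = (if t = 0 then x i 1 else \<alpha> *\<^sub>R (v i t - xh i t))" for t i
  have "(\<Sum>t=1..T. norm (z t i - agent_avg (z t))) \<le> gap_factor * (\<Sum>s<T. \<Sum>j\<in>UNIV. norm (u s j))"
  proof (rule driven_mixing_deviation_sum)
    show "z (Suc t) i = mix (A (Suc t)) (\<lambda>k. z t k + u t k) i" if "t < T" for t i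
      using that xh_eq[of "Suc t" i] by (cases "t = 0") (simp_all add: z_def u_def x_Suc)
  qed (simp add: z_def)
  also have "(\<Sum>t=1..T. norm (z t i - agent_avg (z t))) = (\<Sum>t=1..T. norm (xh i t - x_avg t))"
    by (rule sum.cong) (use agent_avg_xh in \<open>auto simp: z_def[abs_def]\<close>)
  finally have "(\<Sum>t=1..T. norm (xh i t - x_avg t)) \<le> gap_factor * (\<Sum>s<T. \<Sum>j\<in>UNIV. norm (u s j))" .
  moreover have "(\<Sum>s<T. \<Sum>j\<in>UNIV. norm (u s j)) \<le> (\<Sum>j\<in>UNIV. norm (x j 1)) + real CARD('v) * \<alpha> * M * real T"
  proof -
    have "(\<Sum>s<T. \<Sum>j\<in>UNIV. norm (u s j))
        = (\<Sum>j\<in>UNIV. norm (x j 1)) + (\<Sum>s=1..<T. \<Sum>j\<in>UNIV. norm (u s j))"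
      using T by (simp add: lessThan_atLeast0 sum.atLeast_Suc_lessThan u_def)
    also have "(\<Sum>s=1..<T. \<Sum>j\<in>UNIV. norm (u s j)) \<le> (\<Sum>s=1..<T. real CARD('v) * (\<alpha> * M))"
      by (intro sum_mono sum_UNIV_le_card) (use step_norm in \<open>auto simp: u_def\<close>)
    also have "\<dots> \<le> real T * (real CARD('v) * (\<alpha> * M))"
      using alpha M_nonneg by (simp add: mult_right_mono)
    finally show ?thesis by (simp add: mult_ac)
  qed
  ultimately show ?thesis by (rule order_trans[OF _ mult_left_mono[OF _ gap_factor_nonneg]])
qed

text \<open>
  From the second round on, an iterate is a mixed iterate plus one step, and the average moves by one step
  as well. This accounts for \<open>2 * \<alpha> * M\<close> per round.
\<close>

lemma sum_x_deviation:
  "(\<Sum>t=1..T. norm (x i t - x_avg t)) \<le> norm (x i 1 - x_avg 1)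
    + gap_factor * ((\<Sum>j\<in>UNIV. norm (x j 1)) + real CARD('v) * \<alpha> * M * real T) + 2 * \<alpha> * M * real T"
proof -
  have step: "norm (x i (Suc t) - x_avg (Suc t)) \<le> norm (xh i t - x_avg t) + 2 * \<alpha> * M"
    if t: "t \<in> {1..T}" for t
  proof -
    have "norm (x_avg (Suc t) - x_avg t) \<le> \<alpha> * M" by (rule x_avg_step[OF t])
    moreover have "norm (x i (Suc t) - xh i t) \<le> \<alpha> * M"
      unfolding x_Suc[OF t] using step_norm[OF t, of i] by simp
    ultimately show ?thesis
      using norm_diff_triangle3[of "x i (Suc t)" "x_avg (Suc t)" "xh i t" "x_avg t"]
      by (simp add: norm_minus_commute)
  qed
  have "(\<Sum>t=1..T. norm (x i t - x_avg t))
      = norm (x i 1 - x_avg 1) + (\<Sum>t=1..<T. norm (x i (Suc t) - x_avg (Suc t)))"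
    by (rule sum_from_1_split[OF T])
  also have "(\<Sum>t=1..<T. norm (x i (Suc t) - x_avg (Suc t))) \<le> (\<Sum>t=1..T. norm (x i (Suc t) - x_avg (Suc t)))"
    by (rule sum_mono2) auto
  also have "(\<Sum>t=1..T. norm (x i (Suc t) - x_avg (Suc t)))
      \<le> (\<Sum>t=1..T. norm (xh i t - x_avg t) + 2 * \<alpha> * M)"
    by (rule sum_mono) (rule step)
  also have "\<dots> = (\<Sum>t=1..T. norm (xh i t - x_avg t)) + 2 * \<alpha> * M * real T"
    by (simp add: sum.distrib mult_ac)
  finally show ?thesis using sum_xh_deviation[of i] by linarith
qed

text \<open>
  The invariant of gradient tracking: the increments of the trackers are chosen such that their
  average telescopes to the average of the current local gradients.
\<close>

section \<open>Gradient tracking\<close>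

lemma agent_avg_gh:
  assumes "t \<in> {1..T}"
  shows "agent_avg (\<lambda>i. gh i t) = agent_avg (\<lambda>i. grad i t (xh i t))"
proof -
  have mixed: "agent_avg (\<lambda>i. gh i t) = agent_avg (\<lambda>i. gb i t)" if "t \<in> {1..T}" for t
    using agent_avg_mix[OF doubly_stochastic[OF that], of "\<lambda>k. gb k t"] by (simp add: gh_eq[OF that])
  have "agent_avg (\<lambda>i. gb i t) = agent_avg (\<lambda>i. grad i t (xh i t))"
    using assms
  proof (induction t)
    case (Suc t)
    show ?case
    proof (cases "t = 0")
      case True
      then show ?thesis using gb_1 by simp
    next
      case False
      then have t: "t \<in> {1..<T}" using Suc.prems by auto
      have "agent_avg (\<lambda>i. gb i (Suc t)) = agent_avg (\<lambda>i. gh i t)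
          + (agent_avg (\<lambda>i. grad i (Suc t) (xh i (Suc t))) - agent_avg (\<lambda>i. grad i t (xh i t)))"
        by (simp add: gb_Suc[OF t] agent_avg_def sum.distrib sum_subtractf scaleR_add_right scaleR_diff_right)
      then show ?thesis using mixed[of t] Suc.IH t by simp
    qed
  qed simp
  with mixed[OF assms] show ?thesis by simp
qed

lemma gradient_change_le:
  assumes "t \<ge> 1" "y \<in> X"
  shows "norm (grad i (Suc t) y - grad i t y) \<le> (MAX i. SUP y\<in>X. norm (grad i (t + 1) y - grad i t y))"
proof -
  have "continuous_on X (grad i s)" if "s \<ge> 1" for s
    using gradient_lipschitz[OF that] by (rule lipschitz_on_continuous_on)
  then have "continuous_on X (\<lambda>y. norm (grad i (t + 1) y - grad i t y))"
    using assms by (intro continuous_intros) auto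
  then have "bdd_above ((\<lambda>y. norm (grad i (t + 1) y - grad i t y)) ` X)"
    using X by (intro bounded_imp_bdd_above compact_imp_bounded compact_continuous_image)
  from le_Max_SUP[of "\<lambda>i y. norm (grad i (t + 1) y - grad i t y)", OF this assms(2)]
  show ?thesis by simp
qed

lemma loss_change_le:
  assumes "t \<ge> 1" "y \<in> X"
  shows "\<bar>f i (Suc t) y - f i t y\<bar> \<le> (MAX i. SUP y\<in>X. \<bar>f i (t + 1) y - f i t y\<bar>)"
proof -
  have "continuous_on X (f i s)" if "s \<ge> 1" for s
    using loss_lipschitz[OF that] by (rule lipschitz_on_continuous_on)
  then have "continuous_on X (\<lambda>y. \<bar>f i (t + 1) y - f i t y\<bar>)"
    using assms by (intro continuous_intros) auto
  then have "bdd_above ((\<lambda>y. \<bar>f i (t + 1) y - f i t y\<bar>) ` X)"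
    using X by (intro bounded_imp_bdd_above compact_imp_bounded compact_continuous_image)
  from le_Max_SUP[of "\<lambda>i y. \<bar>f i (t + 1) y - f i t y\<bar>", OF this assms(2)]
  show ?thesis by simp
qed

text \<open>
  A local gradient changes in time at a fixed point, which is the variation of the gradients, and by the
  movement of the mixed iterate. The mixed iterate moves by its two consensus errors and the step of the average.
\<close>

lemma sum_gradient_increments:
  "(\<Sum>t=1..<T. \<Sum>j\<in>UNIV. norm (grad j (Suc t) (xh j (Suc t)) - grad j t (xh j t)))
    \<le> real CARD('v) * gradient_variation X grad T
      + G * (2 * (\<Sum>t=1..T. \<Sum>j\<in>UNIV. norm (xh j t - x_avg t)) + real CARD('v) * \<alpha> * M * real T)"
proof -
  define V where "V t = (MAX i. SUP y\<in>X. norm (grad i (t + 1) y - grad i t y))" for t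
  define d where "d t = (\<Sum>j\<in>UNIV. norm (xh j t - x_avg t))" for t
  have d0: "0 \<le> d t" for t by (simp add: d_def sum_nonneg)
  have V0: "0 \<le> V t" if "t \<ge> 1" for t
    using order_trans[OF norm_ge_zero gradient_change_le[OF that start]] by (simp add: V_def)
  have one: "norm (grad j (Suc t) (xh j (Suc t)) - grad j t (xh j t))
      \<le> V t + G * (norm (xh j (Suc t) - x_avg (Suc t)) + norm (xh j t - x_avg t) + \<alpha> * M)"
    if t: "t \<in> {1..<T}" for t j
  proof -
    have "norm (xh j (Suc t) - xh j t)
        \<le> norm (xh j (Suc t) - x_avg (Suc t)) + norm (xh j t - x_avg t) + \<alpha> * M"
      using norm_diff_triangle3[of "xh j (Suc t)" "xh j t" "x_avg (Suc t)" "x_avg t"]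
        x_avg_step[of t] t by (simp add: norm_minus_commute)
    then have "G * norm (xh j (Suc t) - xh j t)
        \<le> G * (norm (xh j (Suc t) - x_avg (Suc t)) + norm (xh j t - x_avg t) + \<alpha> * M)"
      by (rule mult_left_mono) (rule G_nonneg)
    moreover have "norm (grad j (Suc t) (xh j (Suc t)) - grad j (Suc t) (xh j t)) \<le> G * norm (xh j (Suc t) - xh j t)"
      using lipschitz_onD[OF gradient_lipschitz[of "Suc t" j] xh_in[of "Suc t" j] xh_in[of t j]] t
      by (simp add: dist_norm)
    moreover have "norm (grad j (Suc t) (xh j t) - grad j t (xh j t)) \<le> V t"
      unfolding V_def using t by (intro gradient_change_le xh_in) auto
    ultimately show ?thesis
      using norm_triangle_ineq[of "grad j (Suc t) (xh j (Suc t)) - grad j (Suc t) (xh j t)"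
        "grad j (Suc t) (xh j t) - grad j t (xh j t)"] by simp
  qed
  have "(\<Sum>t=1..<T. \<Sum>j\<in>UNIV. norm (grad j (Suc t) (xh j (Suc t)) - grad j t (xh j t)))
      \<le> (\<Sum>t=1..<T. \<Sum>j\<in>UNIV. V t + G * (norm (xh j (Suc t) - x_avg (Suc t)) + norm (xh j t - x_avg t) + \<alpha> * M))"
    by (intro sum_mono one)
  also have "\<dots> = (\<Sum>t=1..<T. real CARD('v) * V t + G * (d (Suc t) + d t + real CARD('v) * (\<alpha> * M)))"
    by (simp add: d_def sum.distrib flip: sum_distrib_left)
  also have "\<dots> = real CARD('v) * (\<Sum>t=1..<T. V t)
      + G * ((\<Sum>t=1..<T. d (Suc t)) + (\<Sum>t=1..<T. d t) + real (T - 1) * (real CARD('v) * (\<alpha> * M)))"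
    by (simp add: sum.distrib flip: sum_distrib_left)
  also have "\<dots> \<le> real CARD('v) * (\<Sum>t=1..T. V t)
      + G * ((\<Sum>t=1..T. d t) + (\<Sum>t=1..T. d t) + real T * (real CARD('v) * (\<alpha> * M)))"
  proof -
    have 1: "(\<Sum>t=1..<T. d (Suc t)) \<le> (\<Sum>t=1..T. d t)"
      unfolding sum_from_1_split[OF T, of d] using d0[of 1] by linarith
    have 2: "(\<Sum>t=1..<T. d t) \<le> (\<Sum>t=1..T. d t)" by (rule sum_mono2) (use d0 in auto)
    have 3: "(\<Sum>t=1..<T. V t) \<le> (\<Sum>t=1..T. V t)" by (rule sum_mono2) (use V0 in auto)
    have 4: "real (T - 1) * (real CARD('v) * (\<alpha> * M)) \<le> real T * (real CARD('v) * (\<alpha> * M))"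
      using alpha M_nonneg by (intro mult_right_mono) auto
    show ?thesis by (intro add_mono mult_left_mono 1 2 3 4 G_nonneg) simp
  qed
  finally show ?thesis by (simp add: gradient_variation_def V_def d_def mult_ac)
qed

text \<open>
  The trackers after mixing form a mixing process that is disturbed by the increments of the local gradients.
\<close>

lemma sum_gh_deviation:
  "(\<Sum>t=1..T. norm (gh i t - agent_avg (\<lambda>i. gh i t)))
    \<le> gap_factor * ((\<Sum>j\<in>UNIV. norm (grad j 1 (xh j 1)))
      + (\<Sum>t=1..<T. \<Sum>j\<in>UNIV. norm (grad j (Suc t) (xh j (Suc t)) - grad j t (xh j t))))"
proof -
  define z where "z t i = (if t = 0 then 0 else gh i t)" for t i
  define u where "u t i = (if t = 0 then gb i 1 else grad i (Suc t) (xh i (Suc t)) - grad i t (xh i t))" for t i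
  have "(\<Sum>t=1..T. norm (z t i - agent_avg (z t))) \<le> gap_factor * (\<Sum>s<T. \<Sum>j\<in>UNIV. norm (u s j))"
  proof (rule driven_mixing_deviation_sum)
    show "z (Suc t) i = mix (A (Suc t)) (\<lambda>k. z t k + u t k) i" if "t < T" for t i
      using that gh_eq[of "Suc t" i] by (cases "t = 0") (simp_all add: z_def u_def gb_Suc)
  qed (simp add: z_def)
  also have "(\<Sum>s<T. \<Sum>j\<in>UNIV. norm (u s j)) = (\<Sum>j\<in>UNIV. norm (grad j 1 (xh j 1)))
      + (\<Sum>s=1..<T. \<Sum>j\<in>UNIV. norm (grad j (Suc s) (xh j (Suc s)) - grad j s (xh j s)))"
    using T gb_1 by (simp add: lessThan_atLeast0 sum.atLeast_Suc_lessThan u_def)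
  also have "(\<Sum>t=1..T. norm (z t i - agent_avg (z t))) = (\<Sum>t=1..T. norm (gh i t - agent_avg (\<lambda>i. gh i t)))"
    by (rule sum.cong) (auto simp: z_def[abs_def])
  finally show ?thesis .
qed

text \<open>
  Two errors separate a tracker from the gradient of the average loss: local gradients are
  evaluated at the mixed iterates instead of their average, and the tracker deviates from the average
  tracker.
\<close>

lemma norm_gradient_error_le:
  assumes t: "t \<in> {1..T}"
  shows "norm ((1 / real CARD('v)) *\<^sub>R (\<Sum>k\<in>UNIV. grad k t (x_avg t)) - gh i t)
    \<le> G / real CARD('v) * (\<Sum>k\<in>UNIV. norm (xh k t - x_avg t)) + norm (gh i t - agent_avg (\<lambda>i. gh i t))"
proof -
  let ?p = "(1 / real CARD('v)) *\<^sub>R (\<Sum>k\<in>UNIV. grad k t (x_avg t))"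
  let ?m = "agent_avg (\<lambda>i. gh i t)"
  have "norm (grad k t (x_avg t) - grad k t (xh k t)) \<le> G * norm (xh k t - x_avg t)" for k
    using lipschitz_onD[OF gradient_lipschitz[of t k] x_avg_in[of t] xh_in[of t k]] t
    by (simp add: dist_norm norm_minus_commute)
  then have "norm (\<Sum>k\<in>UNIV. grad k t (x_avg t) - grad k t (xh k t)) \<le> (\<Sum>k\<in>UNIV. G * norm (xh k t - x_avg t))"
    by (rule sum_norm_le)
  moreover have "?p - ?m = (1 / real CARD('v)) *\<^sub>R (\<Sum>k\<in>UNIV. grad k t (x_avg t) - grad k t (xh k t))"
    unfolding agent_avg_gh[OF t] by (simp add: agent_avg_def sum_subtractf scaleR_diff_right)
  ultimately have "norm (?p - ?m) \<le> G / real CARD('v) * (\<Sum>k\<in>UNIV. norm (xh k t - x_avg t))"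
    by (simp add: sum_distrib_left[symmetric] divide_right_mono)
  then show ?thesis
    using norm_triangle_ineq[of "?p - ?m" "?m - gh i t"] by (simp add: norm_minus_commute)
qed

lemma sum_gradient_error:
  defines "K \<equiv> gap_factor * ((\<Sum>j\<in>UNIV. norm (x j 1)) + real CARD('v) * \<alpha> * M * real T)"
  shows "(\<Sum>t=1..T. \<Sum>i\<in>UNIV. norm ((1 / real CARD('v)) *\<^sub>R (\<Sum>k\<in>UNIV. grad k t (x_avg t)) - gh i t))
    \<le> real CARD('v) * (G * K + gap_factor * ((\<Sum>j\<in>UNIV. norm (grad j 1 (xh j 1)))
      + real CARD('v) * gradient_variation X grad T
      + G * (2 * (real CARD('v) * K) + real CARD('v) * \<alpha> * M * real T)))"
proof -
  define d where "d t = (\<Sum>k\<in>UNIV. norm (xh k t - x_avg t))" for t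
  define e where "e i t = norm (gh i t - agent_avg (\<lambda>i. gh i t))" for i t
  define b where "b = (\<Sum>j\<in>UNIV. norm (grad j 1 (xh j 1)))"
  have d: "(\<Sum>t=1..T. d t) \<le> real CARD('v) * K"
    unfolding d_def K_def by (subst sum.swap) (intro sum_UNIV_le_card sum_xh_deviation)
  define B where "B = gap_factor * (b + (real CARD('v) * gradient_variation X grad T
      + G * (2 * (real CARD('v) * K) + real CARD('v) * \<alpha> * M * real T)))"
  have e: "(\<Sum>t=1..T. e i t) \<le> B" for i
  proof -
    have "(\<Sum>t=1..<T. \<Sum>j\<in>UNIV. norm (grad j (Suc t) (xh j (Suc t)) - grad j t (xh j t)))
        \<le> real CARD('v) * gradient_variation X grad T
          + G * (2 * (\<Sum>t=1..T. d t) + real CARD('v) * \<alpha> * M * real T)"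
      unfolding d_def by (rule sum_gradient_increments)
    also have "\<dots> \<le> real CARD('v) * gradient_variation X grad T
          + G * (2 * (real CARD('v) * K) + real CARD('v) * \<alpha> * M * real T)"
      using d G_nonneg by (intro add_left_mono mult_left_mono add_right_mono) auto
    finally have "gap_factor * (b + (\<Sum>t=1..<T. \<Sum>j\<in>UNIV. norm (grad j (Suc t) (xh j (Suc t)) - grad j t (xh j t)))) \<le> B"
      unfolding B_def by (intro mult_left_mono add_left_mono gap_factor_nonneg)
    with sum_gh_deviation[of i] show ?thesis unfolding e_def b_def by (rule order_trans)
  qed
  have "(\<Sum>t=1..T. \<Sum>i\<in>UNIV. norm ((1 / real CARD('v)) *\<^sub>R (\<Sum>k\<in>UNIV. grad k t (x_avg t)) - gh i t))
      \<le> (\<Sum>t=1..T. \<Sum>i\<in>UNIV. G / real CARD('v) * d t + e i t)"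
    unfolding d_def e_def by (intro sum_mono norm_gradient_error_le)
  also have "\<dots> = G * (\<Sum>t=1..T. d t) + (\<Sum>i\<in>UNIV. \<Sum>t=1..T. e i t)"
    by (simp add: sum.distrib sum_distrib_left sum.swap[of _ _ UNIV])
  also have "\<dots> \<le> G * (real CARD('v) * K) + real CARD('v) * B"
    by (intro add_mono mult_left_mono d G_nonneg sum_UNIV_le_card e)
  finally show ?thesis by (simp add: B_def b_def distrib_left add.assoc mult.left_commute)
qed

section \<open>Dynamic regret\<close>

lemma total_loss_convex: "t \<ge> 1 \<Longrightarrow> convex_on X (total_loss f t)"
proof -
  assume t: "t \<ge> 1"
  have "convex_on X (\<lambda>y. \<Sum>i\<in>I. f i t y)" if "finite I" for I
    using that
  proof (induction I)
    case empty
    show ?case using X by (simp add: convex_on_def)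
  next
    case (insert i I)
    then show ?case using convex_on_add[OF loss_convex[OF t, of i]] by simp
  qed
  then show ?thesis by (simp add: total_loss_def[abs_def])
qed

lemma total_loss_gradient:
  assumes "t \<ge> 1" "y \<in> X"
  shows "GDERIV (total_loss f t) y :> (\<Sum>k\<in>UNIV. grad k t y)"
  using loss_gradient[OF assms] unfolding gderiv_def total_loss_def[abs_def] inner_sum_right
  by (rule has_derivative_sum)

lemma total_gradient_lipschitz:
  assumes "t \<ge> 1"
  shows "(real CARD('v) * G)-lipschitz_on X (\<lambda>y. \<Sum>k\<in>UNIV. grad k t y)"
proof (rule lipschitz_onI)
  fix y z assume yz: "y \<in> X" "z \<in> X"
  have "norm (\<Sum>k\<in>UNIV. grad k t y - grad k t z) \<le> (\<Sum>k\<in>(UNIV::'v set). G * norm (y - z))"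
    by (rule sum_norm_le) (use lipschitz_onD[OF gradient_lipschitz[OF assms] yz] in \<open>simp add: dist_norm\<close>)
  then show "dist (\<Sum>k\<in>UNIV. grad k t y) (\<Sum>k\<in>UNIV. grad k t z) \<le> real CARD('v) * G * dist y z"
    by (simp add: dist_norm sum_subtractf)
qed (simp add: G_nonneg)

lemma total_loss_diff_le:
  assumes "t \<ge> 1" "y \<in> X" "z \<in> X"
  shows "total_loss f t y - total_loss f t z \<le> real CARD('v) * (L * norm (y - z))"
proof -
  have "f i t y - f i t z \<le> L * norm (y - z)" for i
    using lipschitz_onD[OF loss_lipschitz[OF assms(1), of i] assms(2,3)] by (simp add: dist_norm)
  then show ?thesis
    unfolding total_loss_def sum_subtractf[symmetric] by (rule sum_UNIV_le_card)
qed

lemma total_loss_change_le: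
  assumes "t \<ge> 1" "y \<in> X"
  shows "\<bar>total_loss f (Suc t) y - total_loss f t y\<bar>
    \<le> real CARD('v) * (MAX i. SUP y\<in>X. \<bar>f i (t + 1) y - f i t y\<bar>)"
  unfolding total_loss_def sum_subtractf[symmetric]
  by (rule order_trans[OF sum_abs sum_UNIV_le_card]) (rule loss_change_le[OF assms])

text \<open>
  The Frank-Wolfe inequality of each round is solved for the optimality gap; then the sum over all
  rounds is divided by \<open>\<alpha>\<close>. This is where \<open>1 / \<alpha>\<close> enters the bound.
\<close>

lemma sum_optimality_gap:
  "(\<Sum>t=1..T. total_loss f t (x_avg t) - total_loss f t (xstar t))
    \<le> real CARD('v) * L * M / \<alpha> + 2 * real CARD('v) / \<alpha> * function_variation X f T
      + M * (\<Sum>t=1..T. \<Sum>i\<in>UNIV. norm ((1 / real CARD('v)) *\<^sub>R (\<Sum>k\<in>UNIV. grad k t (x_avg t)) - gh i t))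
      + real CARD('v) * G * M\<^sup>2 / 2 * \<alpha> * real T"
proof -
  define F where "F = total_loss f"
  define e where "e t = (\<Sum>i\<in>UNIV. norm ((1 / real CARD('v)) *\<^sub>R (\<Sum>k\<in>UNIV. grad k t (x_avg t)) - gh i t))" for t
  have step: "\<alpha> * (F t (x_avg t) - F t (xstar t)) \<le> (F t (x_avg t) - F t (x_avg (Suc t)))
      + \<alpha> * M * e t + real CARD('v) * G / 2 * (\<alpha> * M)\<^sup>2" if t: "t \<in> {1..T}" for t
  proof -
    have "F t (x_avg t + \<alpha> *\<^sub>R (agent_avg (\<lambda>i. v i t) - x_avg t)) \<le> F t (x_avg t) - \<alpha> * (F t (x_avg t) - F t (xstar t))
      + \<alpha> * M * e t + real CARD('v) * G / 2 * (\<alpha> * M)\<^sup>2"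
      unfolding F_def e_def
      by (rule frank_wolfe_averaged_step[OF X(2) total_loss_convex total_loss_gradient total_gradient_lipschitz diameter])
        (use t alpha v_min x_avg_in comparator in auto)
    then show ?thesis unfolding x_avg_Suc[OF t, symmetric] by simp
  qed
  have "(\<Sum>t=1..T. F t (x_avg t) - F t (x_avg (Suc t)))
      \<le> F 1 (x_avg 1) - F 1 (x_avg (Suc T)) + 2 * (\<Sum>t=1..T. real CARD('v) * (MAX i. SUP y\<in>X. \<bar>f i (t + 1) y - f i t y\<bar>))"
    by (rule telescoping_varying_function[where X = X])
      (use x_avg_in total_loss_change_le in \<open>auto simp: F_def\<close>)
  also have "\<dots> = F 1 (x_avg 1) - F 1 (x_avg (Suc T)) + 2 * real CARD('v) * function_variation X f T"
    by (simp add: function_variation_def sum_distrib_left mult.assoc)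
  also have "F 1 (x_avg 1) - F 1 (x_avg (Suc T)) \<le> real CARD('v) * L * M"
  proof -
    have "F 1 (x_avg 1) - F 1 (x_avg (Suc T)) \<le> real CARD('v) * (L * norm (x_avg 1 - x_avg (Suc T)))"
      unfolding F_def by (intro total_loss_diff_le x_avg_in) auto
    also have "\<dots> \<le> real CARD('v) * (L * M)"
      by (intro mult_left_mono diameter x_avg_in lipschitz_on_nonneg[OF loss_lipschitz[of 1 undefined]]) auto
    finally show ?thesis by (simp add: mult.assoc)
  qed
  finally have tele: "(\<Sum>t=1..T. F t (x_avg t) - F t (x_avg (Suc t)))
      \<le> real CARD('v) * L * M + 2 * real CARD('v) * function_variation X f T" by simp
  have "\<alpha> * (\<Sum>t=1..T. F t (x_avg t) - F t (xstar t))
      \<le> (\<Sum>t=1..T. (F t (x_avg t) - F t (x_avg (Suc t))) + \<alpha> * M * e t + real CARD('v) * G / 2 * (\<alpha> * M)\<^sup>2)"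
    unfolding sum_distrib_left by (rule sum_mono) (rule step)
  also have "\<dots> = (\<Sum>t=1..T. F t (x_avg t) - F t (x_avg (Suc t))) + \<alpha> * M * (\<Sum>t=1..T. e t)
      + real T * (real CARD('v) * G / 2 * (\<alpha> * M)\<^sup>2)"
    by (simp only: sum.distrib sum_distrib_left sum_constant card_atLeastAtMost diff_Suc_1)
  also have "\<dots> \<le> (real CARD('v) * L * M + 2 * real CARD('v) * function_variation X f T) + \<alpha> * M * (\<Sum>t=1..T. e t)
      + real T * (real CARD('v) * G / 2 * (\<alpha> * M)\<^sup>2)"
    using tele by (intro add_right_mono)
  finally have "(\<Sum>t=1..T. F t (x_avg t) - F t (xstar t)) \<le> ((real CARD('v) * L * M
      + 2 * real CARD('v) * function_variation X f T) + \<alpha> * M * (\<Sum>t=1..T. e t)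
      + real T * (real CARD('v) * G / 2 * (\<alpha> * M)\<^sup>2)) / \<alpha>"
    using alpha by (simp add: pos_le_divide_eq mult.commute)
  also have "\<dots> = real CARD('v) * L * M / \<alpha> + 2 * real CARD('v) / \<alpha> * function_variation X f T
      + M * (\<Sum>t=1..T. e t) + real CARD('v) * G * M\<^sup>2 / 2 * \<alpha> * real T"
    using alpha by (simp add: add_divide_distrib power2_eq_square)
  finally show ?thesis unfolding F_def e_def .
qed

text \<open>
  The bound in the form in which the argument produces it. The number \<open>K\<close> is the bound of
  \<open>sum_xh_deviation\<close> for the accumulated consensus error of one agent.
\<close>

theorem dynamic_regret_le:
  defines "K \<equiv> gap_factor * ((\<Sum>j\<in>UNIV. norm (x j 1)) + real CARD('v) * \<alpha> * M * real T)"
  shows "dynamic_regret f x xstar j T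
    \<le> real CARD('v) * L * (norm (x j 1 - x_avg 1) + K + 2 * \<alpha> * M * real T)
      + real CARD('v) * L * M / \<alpha> + 2 * real CARD('v) / \<alpha> * function_variation X f T
      + M * (real CARD('v) * (G * K + gap_factor * ((\<Sum>j\<in>UNIV. norm (grad j 1 (xh j 1)))
        + real CARD('v) * gradient_variation X grad T
        + G * (2 * (real CARD('v) * K) + real CARD('v) * \<alpha> * M * real T))))
      + real CARD('v) * G * M\<^sup>2 / 2 * \<alpha> * real T"
proof -
  have L0: "0 \<le> L" by (rule lipschitz_on_nonneg[OF loss_lipschitz[of 1 undefined]]) simp
  have "(\<Sum>t=1..T. total_loss f t (x j t) - total_loss f t (x_avg t))
      \<le> (\<Sum>t=1..T. real CARD('v) * (L * norm (x j t - x_avg t)))"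
    by (intro sum_mono total_loss_diff_le x_in x_avg_in) auto
  also have "\<dots> = real CARD('v) * L * (\<Sum>t=1..T. norm (x j t - x_avg t))"
    by (simp add: sum_distrib_left mult.assoc)
  also have "\<dots> \<le> real CARD('v) * L * (norm (x j 1 - x_avg 1) + K + 2 * \<alpha> * M * real T)"
    unfolding K_def by (intro mult_left_mono sum_x_deviation mult_nonneg_nonneg L0) simp
  finally have "(\<Sum>t=1..T. total_loss f t (x j t) - total_loss f t (x_avg t))
      \<le> real CARD('v) * L * (norm (x j 1 - x_avg 1) + K + 2 * \<alpha> * M * real T)" .
  moreover have "dynamic_regret f x xstar j T = (\<Sum>t=1..T. total_loss f t (x j t) - total_loss f t (x_avg t))
      + (\<Sum>t=1..T. total_loss f t (x_avg t) - total_loss f t (xstar t))"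
    by (simp add: dynamic_regret_def sum_subtractf)
  moreover note sum_optimality_gap mult_left_mono[OF sum_gradient_error M_nonneg, folded K_def]
  ultimately show ?thesis by linarith
qed

lemma gradient_variation_nonneg: "0 \<le> gradient_variation X grad T"
  unfolding gradient_variation_def
  by (rule sum_nonneg, rule order_trans[OF norm_ge_zero gradient_change_le[OF _ start]]) simp

end

text \<open>
  Here \<open>P\<close> stands for \<open>\<Gamma> / (1 - \<sigma>)\<close>, \<open>r'\<close> for the initial deviation of one agent, \<open>r\<close> for that of all
  agents, and \<open>a\<close>, \<open>b\<close>, \<open>D\<close> for the initial iterates, the initial gradients and the gradient variation.
\<close>

lemma regret_constants_le:
  fixes n L M G P \<alpha> T a b r D :: real
  assumes "1 \<le> n" "0 \<le> L" "0 \<le> M" "0 \<le> G" "0 \<le> P" "0 \<le> \<alpha>" "0 \<le> T" "0 \<le> a" "0 \<le> b" "0 \<le> D"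
    and r: "r' \<le> r" "0 \<le> r'"
  defines "K \<equiv> P * (a + n * \<alpha> * M * T)"
  shows "n * L * (r' + K + 2 * \<alpha> * M * T)
      + M * (n * (G * K + P * (b + n * D + G * (2 * (n * K) + n * \<alpha> * M * T)))) + n * G * M\<^sup>2 / 2 * \<alpha> * T
    \<le> (n * L * r + 2 * M * n * P * b + (n * L + 2 * M * G + 4 * M * n * P * G) * (n * P) * a)
      + (2 * n\<^sup>2 * L * M + (4 * M * G + n * L + 4 * M * n * P * G) * (n\<^sup>2 * M * P) + n * G * M\<^sup>2 / 2) * \<alpha> * T
      + (2 * M * n\<^sup>2 * P + n * M) * D"
proof -
  note nn = mult_nonneg_nonneg add_nonneg_nonneg
  have n0: "0 \<le> n" "0 \<le> n - 1" using assms by auto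
  \<comment> \<open>The difference of the two sides, grouped into nonnegative terms. The factors \<open>n - 1\<close> stem from places
    where the right-hand side counts all agents and the left-hand side only one.\<close>
  have "0 \<le> n * L * (r - r') + M * n * P * b + (n - 1) * (n * L * P * a) + M * G * n * P * a
      + 2 * (M * n * P * G * n * P * a) + (n - 1) * (2 * n * L * M * \<alpha> * T)
      + (n - 1) * (n * L * P * n * \<alpha> * M * T) + 2 * (M * G * n * n * M * P * \<alpha> * T)
      + 2 * (M * n * P * G * n * n * M * P * \<alpha> * T) + M * n * n * P * D + n * M * D"
    by (intro nn) (use assms n0 in auto)
  then show ?thesis unfolding K_def by (simp add: algebra_simps power2_eq_square)
qed

theorem theorem1:
  fixes X :: "(real^'d) set"
    and f :: "'v::finite \<Rightarrow> nat \<Rightarrow> real^'d \<Rightarrow> real"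
    and grad :: "'v \<Rightarrow> nat \<Rightarrow> real^'d \<Rightarrow> real^'d"
    and xstar :: "nat \<Rightarrow> real^'d"
    and E :: "nat \<Rightarrow> 'v rel"
    and A :: "nat \<Rightarrow> real^'v^'v"
    and x xh gb gh v :: "'v \<Rightarrow> nat \<Rightarrow> real^'d"
    and \<alpha> \<zeta> M L\<^sub>X G\<^sub>X :: real
    and n \<sigma> \<Gamma> C\<^sub>1 C\<^sub>2 C\<^sub>3 C\<^sub>4 :: real
    and T Q :: nat
    and j :: 'v
  assumes X: "X \<noteq> {}" "convex X" "compact X"
    and loss_convex: "\<And>i t. t \<ge> 1 \<Longrightarrow> convex_on X (f i t)"
    and loss_gradient: "\<And>i t y. t \<ge> 1 \<Longrightarrow> y \<in> X \<Longrightarrow> GDERIV (f i t) y :> grad i t y"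
    and optimal: "\<And>t. t \<ge> 1 \<Longrightarrow> is_arg_min (total_loss f t) (\<lambda>y. y \<in> X) (xstar t)"
    and weights: "\<And>t. t \<ge> 1 \<Longrightarrow> compatible_weights (E t) (A t)"
    and T: "T \<ge> 2"
    and alpha: "0 < \<alpha>" "\<alpha> \<le> 1"
    and algorithm: "dofw_co X grad E A \<alpha> T x xh gb gh v"
    and zeta: "\<zeta> > 0"
      "\<And>t i k. t \<in> {1..T} \<Longrightarrow> A t $ i $ k > 0 \<Longrightarrow> A t $ i $ k > \<zeta>"
    and row_sums: "\<And>t i. t \<in> {1..T} \<Longrightarrow> (\<Sum>k\<in>UNIV. A t $ i $ k) = 1"
    and column_sums: "\<And>t k. t \<in> {1..T} \<Longrightarrow> (\<Sum>i\<in>UNIV. A t $ i $ k) = 1"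
    and connectivity: "Q > 0"
      "\<And>k. strongly_connected (with_proj (union_graph E {k * Q + 1..(k + 1) * Q}))"
    and diameter: "\<And>y z. y \<in> X \<Longrightarrow> z \<in> X \<Longrightarrow> norm (y - z) \<le> M"
    and loss_lipschitz: "L\<^sub>X > 0" "\<And>i t. t \<ge> 1 \<Longrightarrow> L\<^sub>X-lipschitz_on X (f i t)"
    and gradient_lipschitz: "\<And>i t. t \<ge> 1 \<Longrightarrow> G\<^sub>X-lipschitz_on X (grad i t)"
    and n: "n = real CARD('v)"
    and sigma: "\<sigma> = (1 - \<zeta> / (4 * n\<^sup>2)) powr (1 / real Q)"
    and Gamma: "\<Gamma> = (1 - \<zeta> / (4 * n\<^sup>2)) powr ((1 - 2 * real Q) / real Q)"
    and C1: "C\<^sub>1 = n * L\<^sub>X * (\<Sum>i\<in>UNIV. norm (x i 1 - agent_avg (\<lambda>k. x k 1)))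
      + 2 * M * n * \<Gamma> / (1 - \<sigma>) * (\<Sum>i\<in>UNIV. norm (grad i 1 (xh i 1)))
      + (n * L\<^sub>X + 2 * M * G\<^sub>X + 4 * M * n * \<Gamma> * G\<^sub>X / (1 - \<sigma>))
        * (n * \<Gamma> / (1 - \<sigma>)) * (\<Sum>i\<in>UNIV. norm (x i 1))"
    and C2: "C\<^sub>2 = 2 * n\<^sup>2 * L\<^sub>X * M
      + (4 * M * G\<^sub>X + n * L\<^sub>X + 4 * M * n * \<Gamma> * G\<^sub>X / (1 - \<sigma>)) * (n\<^sup>2 * M * \<Gamma> / (1 - \<sigma>))
      + n * G\<^sub>X * M\<^sup>2 / 2"
    and C3: "C\<^sub>3 = n * L\<^sub>X * M"
    and C4: "C\<^sub>4 = 2 * M * n\<^sup>2 * \<Gamma> / (1 - \<sigma>) + n * M"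
  shows "dynamic_regret f x xstar j T \<le>
    C\<^sub>1 + C\<^sub>2 * \<alpha> * real T + 2 * n / \<alpha> * function_variation X f T + C\<^sub>3 / \<alpha>
    + C\<^sub>4 * gradient_variation X grad T"
proof -
  have L0: "0 \<le> L\<^sub>X" using loss_lipschitz(1) by simp
  interpret dofw_run E A \<zeta> T Q "1 - \<zeta> / (4 * n\<^sup>2)" \<sigma> \<Gamma> X f grad xstar x xh gb gh v \<alpha> M L\<^sub>X G\<^sub>X
    by unfold_locales
      (use assms in \<open>auto simp: is_arg_min_linorder\<close>)
  let ?a = "\<Sum>i\<in>UNIV. norm (x i 1)" and ?b = "\<Sum>i\<in>UNIV. norm (grad i 1 (xh i 1))"
  let ?r = "\<Sum>i\<in>UNIV. norm (x i 1 - x_avg 1)"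
  let ?K = "gap_factor * (?a + n * \<alpha> * M * real T)"
  have r: "norm (x j 1 - x_avg 1) \<le> ?r" by (rule member_le_sum) auto
  have n1: "1 \<le> n" using n by (simp add: Suc_leI)
  have "n * L\<^sub>X * (norm (x j 1 - x_avg 1) + ?K + 2 * \<alpha> * M * real T)
      + M * (n * (G\<^sub>X * ?K + gap_factor * (?b + n * gradient_variation X grad T
          + G\<^sub>X * (2 * (n * ?K) + n * \<alpha> * M * real T)))) + n * G\<^sub>X * M\<^sup>2 / 2 * \<alpha> * real T
    \<le> C\<^sub>1 + C\<^sub>2 * \<alpha> * real T + C\<^sub>4 * gradient_variation X grad T"
    unfolding C1 C2 C4
    using regret_constants_le[OF n1 L0 M_nonneg G_nonneg gap_factor_nonneg _ _ _ _ gradient_variation_nonneg r,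
        of \<alpha> "real T" ?a ?b] alpha
    by (simp add: sum_nonneg)
  with dynamic_regret_le[of j] show ?thesis
    unfolding C3 n[symmetric] by (simp add: add_divide_distrib)
qed

end
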